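(* Consider the Edge Lasso estimator $\widehat f=\arg\min_{f\in\mathbb{R}^n}\{\|Y-f\|_n^2+2\lambda\|Df\|_1\}$, with $Y=f^0+\epsilon$, $\epsilon\sim\mathcal{N}_n(0,\sigma^2I_n)$, on a "large enough" tree graph with $n$ vertices. The irrepresentable condition for the corresponding (almost) ordinary Lasso problem is satisfied if and only if the following hold. (A) For each path graph connecting branching points, at least one of the following holds for the true jumps $i_1,\ldots,i_r$ (in order) along that path: the jump points are consecutive, i.e. $r=1$ or $i_k-i_{k-1}=1$ for all $2\le k\le r$ (positions counted along the path); or the jumps have alternating signs, i.e. $\mathrm{sgn}(i_k)\,\mathrm{sgn}(i_{k+1})<0$ for all $k=1,\ldots,r-1$. (B) Around any ramification point involving $K+1$ edges, with surrounding jumps $j_1$ (just before) and $j_2,\ldots,j_{K+1}$ (right after): 1. $\mathrm{sgn}(j_1)\,\mathrm{sgn}(j_l)<0$ for all $l\in\{l^*\in\{2,\ldots,K+1\}: b_{l^*}\ne0\}$; 2. $\mathrm{sgn}(j_l)\,\mathrm{sgn}(j_{l'})>0$ for all $l,l'\in\{l^*\in\{2,\ldots,K+1\}: b_{l^*}\ne0\}$; 3. $b_1-1,\,b_2,\ldots,b_{K+1}<\frac{2}{K+1}b^*$. If $b_1=1$, condition 1 in (B) is removed.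
   Context: $\|v\|_n^2=\frac1n\sum_iv_i^2$. The tree has vertices $1,\ldots,n$, is rooted at vertex $1$, and is labelled so that each vertex $i\ge2$ has a parent $\mathrm{pa}(i)<i$ (its neighbour towards the root); the edge between $\mathrm{pa}(i)$ and $i$ is indexed by $i$, and $(Df)_i=f_i-f_{\mathrm{pa}(i)}$ for $i=2,\ldots,n$. The path matrix $X\in\mathbb{R}^{n\times n}$ has $X_{ij}=1$ if $j$ lies on the path from $1$ to $i$ (endpoints included) and $0$ otherwise; with $f=X\beta$ the problem becomes a Lasso in $\beta$ with design $X$ and the first coefficient unpenalized. Let $\beta^0_i=f^0_i-f^0_{\mathrm{pa}(i)}$ for $i\ge2$, $S_0=\{i\in\{2,\ldots,n\}:\beta^0_i\ne0\}$, $R=\{2,\ldots,n\}\setminus S_0$, and write $\mathrm{sgn}(j):=\mathrm{sgn}(\beta^0_j)$. Irrepresentable condition: there exists $\eta\in(0,1]$ with $$\|X_R'A_1X_{S_0}(X_{S_0}'A_1X_{S_0})^{-1}z^0_{S_0}\|_\infty\le1-\eta,$$ where $z^0_{S_0}=\mathrm{sgn}(\beta^0_{S_0})$, $X_T$ denotes the columns of $X$ in $T$, and $A_1=I_n-\frac1n\mathbf{1}\mathbf{1}'$ is the projection onto the orthogonal complement of the first column $X_1=\mathbf{1}$. "Large enough" tree graph: by removing $g-1$ edges, each joining extremities (end vertices) of two paths, and none of them in $S_0$, the tree is decomposed into $g$ vertex-disjoint path graphs covering all vertices; the edges of $S_0$ in the $i$-th path ($s_i$ of them) cut it into $s_i+1$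 segments with $d^i_1,\ldots,d^i_{s_i+1}$ vertices, and $d^i_j\ge4$ for all $i,j$. Each path graph meeting at a ramification point contains at least one true jump. Ramification point with $K+1$ edges: one path graph (the main branch, on the root side) ends at the ramification point and $K$ path graphs (branches) are attached to it. $j_1$ denotes the last element of $S_0$ in the main branch before the ramification point, and $j_l$ ($l=2,\ldots,K+1$) the first element of $S_0$ in the $l$-th branch after it. $b_1$ is the number of vertices between $j_1$ and the ramification point, both included; $b_l$ ($l\ge2$) is the number of vertices of the $l$-th branch after the ramification point and before $j_l$; $b^*=\sum_{l=1}^{K+1}b_l$.
   Formalization: The formal theorem also assumes that the root, vertex 1, is an end vertex (degree at most 1); with the root inside a path and a jump on either side, equal signs satisfy the irrepresentable condition while (A) fails. *)

theory Defs
  imports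
    "HOL-Probability.Probability"
    "Jordan_Normal_Form.Gauss_Jordan_Elimination"
begin

section \<open>Rooted trees given by a parent map\<close>

text \<open>
  The vertices are \<open>1, \<dots>, n\<close>, the root is \<open>1\<close>, and the edge between \<open>pa i\<close> and \<open>i\<close> is indexed
  by \<open>i \<in> {2..n}\<close>. Values of \<open>pa\<close> outside \<open>{2..n}\<close> are irrelevant.
\<close>

definition rooted_tree :: "nat \<Rightarrow> (nat \<Rightarrow> nat) \<Rightarrow> bool" where
  "rooted_tree n pa \<longleftrightarrow> 1 \<le> n \<and> (\<forall>i\<in>{2..n}. 1 \<le> pa i \<and> pa i < i)"

definition adjacent :: "nat \<Rightarrow> (nat \<Rightarrow> nat) \<Rightarrow> nat \<Rightarrow> nat \<Rightarrow> bool" where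
  "adjacent n pa u v \<longleftrightarrow> (v \<in> {2..n} \<and> pa v = u) \<or> (u \<in> {2..n} \<and> pa u = v)"

definition children :: "nat \<Rightarrow> (nat \<Rightarrow> nat) \<Rightarrow> nat \<Rightarrow> nat set" where
  "children n pa v = {i \<in> {2..n}. pa i = v}"

definition vertex_degree :: "nat \<Rightarrow> (nat \<Rightarrow> nat) \<Rightarrow> nat \<Rightarrow> nat" where
  "vertex_degree n pa v = card {u \<in> {1..n}. adjacent n pa u v}"

definition ramification_point :: "nat \<Rightarrow> (nat \<Rightarrow> nat) \<Rightarrow> nat \<Rightarrow> bool" where
  "ramification_point n pa v \<longleftrightarrow> v \<in> {1..n} \<and> vertex_degree n pa v \<ge> 3"

definition vertex_path :: "nat \<Rightarrow> (nat \<Rightarrow> nat) \<Rightarrow> nat list \<Rightarrow> bool" where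
  "vertex_path n pa xs \<longleftrightarrow>
     xs \<noteq> [] \<and> distinct xs \<and> set xs \<subseteq> {1..n} \<and> successively (adjacent n pa) xs"

text \<open>Since \<open>pa i < i\<close>, the edge joining two adjacent vertices is indexed by the larger of them.\<close>

definition path_edges :: "nat list \<Rightarrow> nat set" where
  "path_edges xs = {max (xs ! k) (xs ! Suc k) |k. Suc k < length xs}"


section \<open>Edge Lasso and the equivalent Lasso problem\<close>

definition edge_diff :: "(nat \<Rightarrow> nat) \<Rightarrow> (nat \<Rightarrow> real) \<Rightarrow> nat \<Rightarrow> real" where
  "edge_diff pa f i = f i - f (pa i)"

definition edge_lasso_objective ::
    "nat \<Rightarrow> (nat \<Rightarrow> nat) \<Rightarrow> real \<Rightarrow> (nat \<Rightarrow> real) \<Rightarrow> (nat \<Rightarrow> real) \<Rightarrow> real" where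
  "edge_lasso_objective n pa lam Y f =
     (1 / real n) * (\<Sum>i=1..n. (Y i - f i)\<^sup>2) + 2 * lam * (\<Sum>i=2..n. \<bar>edge_diff pa f i\<bar>)"

text \<open>\<open>\<real>\<^sup>n\<close> is represented by the extensional functions on \<open>{1..n}\<close>.\<close>

definition edge_lasso_estimator ::
    "nat \<Rightarrow> (nat \<Rightarrow> nat) \<Rightarrow> real \<Rightarrow> (nat \<Rightarrow> real) \<Rightarrow> (nat \<Rightarrow> real) \<Rightarrow> bool" where
  "edge_lasso_estimator n pa lam Y f \<longleftrightarrow>
     is_arg_min (edge_lasso_objective n pa lam Y) (\<lambda>f. f \<in> {1..n} \<rightarrow>\<^sub>E UNIV) f"

definition gaussian_noise :: "'a measure \<Rightarrow> nat \<Rightarrow> real \<Rightarrow> (nat \<Rightarrow> 'a \<Rightarrow> real) \<Rightarrow> bool" where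
  "gaussian_noise M n \<sigma> \<epsilon> \<longleftrightarrow>
     prob_space M \<and>
     prob_space.indep_vars M (\<lambda>_. borel) \<epsilon> {1..n} \<and>
     (\<forall>i\<in>{1..n}. distributed M lborel (\<epsilon> i) (normal_density 0 \<sigma>))"

definition true_jumps :: "nat \<Rightarrow> (nat \<Rightarrow> nat) \<Rightarrow> (nat \<Rightarrow> real) \<Rightarrow> nat set" where
  "true_jumps n pa f0 = {i \<in> {2..n}. edge_diff pa f0 i \<noteq> 0}"

definition jump_sgn :: "(nat \<Rightarrow> nat) \<Rightarrow> (nat \<Rightarrow> real) \<Rightarrow> nat \<Rightarrow> real" where
  "jump_sgn pa f0 j = sgn (edge_diff pa f0 j)"

text \<open>Matrix indices start at \<open>0\<close>, so row and column \<open>k\<close> belong to vertex \<open>k + 1\<close>.\<close>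

definition path_matrix :: "nat \<Rightarrow> (nat \<Rightarrow> nat) \<Rightarrow> real Matrix.mat" where
  "path_matrix n pa = Matrix.mat n n (\<lambda>(i, j).
     if \<exists>xs. vertex_path n pa xs \<and> hd xs = 1 \<and> last xs = i + 1 \<and> j + 1 \<in> set xs
     then 1 else 0)"

definition columns_at :: "real Matrix.mat \<Rightarrow> nat set \<Rightarrow> real Matrix.mat" where
  "columns_at X T =
     mat_of_cols (dim_row X) (map (\<lambda>j. Matrix.col X (j - 1)) (sorted_list_of_set T))"

definition centering_matrix :: "nat \<Rightarrow> real Matrix.mat" where
  "centering_matrix n = 1\<^sub>m n - (1 / real n) \<cdot>\<^sub>m Matrix.mat n n (\<lambda>_. 1)"

text \<open>Inserting \<open>0\<close> gives the empty vector norm \<open>0\<close>.\<close>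

definition sup_norm_vec :: "real Matrix.vec \<Rightarrow> real" where
  "sup_norm_vec v = Max (insert 0 ((\<lambda>i. \<bar>vec_index v i\<bar>) ` {..<dim_vec v}))"

definition irrepresentable_condition :: "nat \<Rightarrow> (nat \<Rightarrow> nat) \<Rightarrow> (nat \<Rightarrow> real) \<Rightarrow> bool" where
  "irrepresentable_condition n pa f0 \<longleftrightarrow>
     (let S0 = true_jumps n pa f0;
          XS = columns_at (path_matrix n pa) S0;
          XR = columns_at (path_matrix n pa) ({2..n} - S0);
          A1 = centering_matrix n;
          z = vec_of_list (map (jump_sgn pa f0) (sorted_list_of_set S0));
          G = transpose_mat XS * A1 * XS
      in \<exists>\<eta>. 0 < \<eta> \<and> \<eta> \<le> 1 \<and>
           sup_norm_vec ((transpose_mat XR * A1 * XS * the (mat_inverse G)) *\<^sub>v z) \<le> 1 - \<eta>)"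


section \<open>Large enough tree graphs\<close>

text \<open>
  A position \<open>k\<close> in the list stands for the edge between its entries \<open>k - 1\<close> and \<open>k\<close>; cutting there
  leaves entries \<open>\<dots>, k - 1\<close> on one side and \<open>k, \<dots>\<close> on the other.
\<close>

definition segment_lengths :: "nat set \<Rightarrow> nat list \<Rightarrow> nat list" where
  "segment_lengths S xs =
     (let cuts = filter (\<lambda>k. max (xs ! (k - 1)) (xs ! k) \<in> S) [1..<length xs];
          bounds = 0 # cuts @ [length xs]
      in map (\<lambda>j. bounds ! Suc j - bounds ! j) [0..<length bounds - 1])"

text \<open>\<open>P\<close> is the set of the \<open>g\<close> path graphs and \<open>C\<close> the set of the \<open>g - 1\<close> removed edges.\<close>

definition large_enough :: "nat \<Rightarrow> (nat \<Rightarrow> nat) \<Rightarrow> nat set \<Rightarrow> bool" where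
  "large_enough n pa S \<longleftrightarrow>
     (\<exists>P C.
        finite P \<and> (\<forall>xs\<in>P. vertex_path n pa xs) \<and>
        pairwise (\<lambda>xs ys. disjnt (set xs) (set ys)) P \<and>
        (\<Union>xs\<in>P. set xs) = {1..n} \<and>
        C \<subseteq> {2..n} - S \<and> card C + 1 = card P \<and>
        {2..n} - C = (\<Union>xs\<in>P. path_edges xs) \<and>
        (\<forall>e\<in>C. \<exists>xs\<in>P. \<exists>ys\<in>P. xs \<noteq> ys \<and>
            pa e \<in> {hd xs, last xs} \<and> e \<in> {hd ys, last ys}) \<and>
        (\<forall>xs\<in>P. \<forall>d \<in> set (segment_lengths S xs). 4 \<le> d))"


section \<open>Path graphs between ramification points\<close>

text \<open>
  The maximal paths, listed away from the root, with no ramification point except possibly at the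
  end. A ramification point is the last vertex of its main branch, and each of its children is the
  first vertex of a branch. Every vertex other than the root also stands for the edge to its parent,
  so jumps along such a path are entries of the list that lie in the jump set.
\<close>

definition branch_path :: "nat \<Rightarrow> (nat \<Rightarrow> nat) \<Rightarrow> nat list \<Rightarrow> bool" where
  "branch_path n pa xs \<longleftrightarrow>
     vertex_path n pa xs \<and>
     successively (\<lambda>u v. v \<in> children n pa u) xs \<and>
     (hd xs = 1 \<or> ramification_point n pa (pa (hd xs))) \<and>
     (\<forall>v \<in> set (butlast xs). \<not> ramification_point n pa v) \<and>
     (ramification_point n pa (last xs) \<or> children n pa (last xs) = {})"

definition jumps_around_ramifications :: "nat \<Rightarrow> (nat \<Rightarrow> nat) \<Rightarrow> nat set \<Rightarrow> bool" where
  "jumps_around_ramifications n pa S \<longleftrightarrow>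
     (\<forall>xs. branch_path n pa xs \<and> (hd xs \<noteq> 1 \<or> ramification_point n pa (last xs))
        \<longrightarrow> set xs \<inter> S \<noteq> {})"

definition condition_A :: "nat \<Rightarrow> (nat \<Rightarrow> nat) \<Rightarrow> (nat \<Rightarrow> real) \<Rightarrow> bool" where
  "condition_A n pa f0 \<longleftrightarrow>
     (\<forall>xs. branch_path n pa xs \<longrightarrow>
        (let pos = filter (\<lambda>k. xs ! k \<in> true_jumps n pa f0) [0..<length xs];
             r = length pos;
             sg = (\<lambda>k. jump_sgn pa f0 (xs ! (pos ! k)))
         in (r = 1 \<or> (\<forall>k. 1 \<le> k \<and> k < r \<longrightarrow> pos ! k - pos ! (k - 1) = 1)) \<or>
            (\<forall>k. k + 1 < r \<longrightarrow> sg k * sg (k + 1) < 0)))"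

text \<open>
  The main branch ending at the ramification point \<open>v\<close> is \<open>m\<close>, and the \<open>K\<close> branches \<open>br c\<close> attached
  to \<open>v\<close> are indexed by the children \<open>c\<close> of \<open>v\<close>. The jump \<open>j\<close> is on the edge above vertex \<open>j\<close>, so
  the vertices from \<open>j1\<close> to \<open>v\<close> include vertex \<open>j1\<close>, while vertex \<open>j c\<close> is not counted in \<open>b c\<close>.
\<close>

definition condition_B :: "nat \<Rightarrow> (nat \<Rightarrow> nat) \<Rightarrow> (nat \<Rightarrow> real) \<Rightarrow> bool" where
  "condition_B n pa f0 \<longleftrightarrow>
     (\<forall>v m br. ramification_point n pa v \<and> branch_path n pa m \<and> last m = v \<and>
        (\<forall>c \<in> children n pa v. branch_path n pa (br c) \<and> hd (br c) = c) \<longrightarrow>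
        (let S0 = true_jumps n pa f0;
             ch = children n pa v;
             K = card ch;
             j1 = last (filter (\<lambda>u. u \<in> S0) m);
             j = (\<lambda>c. hd (filter (\<lambda>u. u \<in> S0) (br c)));
             b1 = length (dropWhile (\<lambda>u. u \<noteq> j1) m);
             b = (\<lambda>c. length (takeWhile (\<lambda>u. u \<noteq> j c) (br c)));
             bstar = b1 + (\<Sum>c\<in>ch. b c);
             sg = jump_sgn pa f0
         in (b1 \<noteq> 1 \<longrightarrow> (\<forall>c\<in>ch. b c \<noteq> 0 \<longrightarrow> sg j1 * sg (j c) < 0)) \<and>
            (\<forall>c\<in>ch. \<forall>c'\<in>ch. b c \<noteq> 0 \<and> b c' \<noteq> 0 \<longrightarrow> sg (j c) * sg (j c') > 0) \<and>
            real b1 - 1 < 2 / (real K + 1) * real bstar \<and>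
            (\<forall>c\<in>ch. real (b c) < 2 / (real K + 1) * real bstar)))"

end

theory Submission
  imports Defs "Jordan_Normal_Form.Determinant"
begin

text \<open>
  Write \<open>S\<close> for the set of true jumps, \<open>z\<close> for their signs, \<open>G\<close> for the Gram matrix
  \<open>X\<^sub>S' A\<^sub>1 X\<^sub>S\<close>, and put \<open>w = A\<^sub>1 X\<^sub>S G\<inverse> z\<close>. Column \<open>j\<close> of the path matrix is the indicator of the
  subtree below \<open>j\<close>, so every entry that the irrepresentable condition bounds is a subtree sum
  \<open>W i\<close> of \<open>w\<close>. Three facts pin \<open>w\<close> down: it does not change across an edge outside \<open>S\<close>, its total
  \<open>W 1\<close> is \<open>0\<close>, and \<open>W j = z j\<close> at every jump \<open>j\<close>. The condition says that
  \<open>\<bar>W i\<bar> < 1\<close> at all other edges (\<open>irrepresentable_condition_profile\<close>).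

  Subtree sums satisfy \<open>W v = w v + (sum of W over the children of v)\<close>, and \<open>w\<close> is constant on the
  components left by cutting the jumps. Hence \<open>W\<close> is linear along each stretch of a component that
  does not branch (\<open>W_branch_linear\<close>), and it is pinned at the ends of the stretch: to a sign
  at a jump, to \<open>0\<close> at the root, to \<open>0\<close> one step past a leaf. Between two jumps the linear
  function stays strictly inside \<open>(-1, 1)\<close> exactly when the end values differ, that is, when the
  signs alternate. This is condition (A); its other alternative, consecutive jumps, only
  occurs with at most one jump, because a large enough tree has no two adjacent jumps
  (\<open>large_enough_jump_isolated\<close>). Stretches ending at the root or at a leaf are always fine.

  A component contains at most one ramification point, since every path between two of them carries
  a jump. It is then a star: a main arm with \<open>b1\<close> vertices from \<open>j1\<close> to the ramification point and one
  arm with \<open>b c\<close> vertices for each child \<open>c\<close>. With \<open>\<omega>\<close> the value of \<open>w\<close> on the star, \<open>W\<close> goes down by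
  \<open>\<omega>\<close> per step away from the root, and the balance at the centre reads
  \<open>z1 - (sum of the z c) = bstar * \<omega>\<close>. An arm that starts from a sign \<open>u\<close> and moves by \<open>\<omega>\<close> in each
  of \<open>N\<close> steps stays inside \<open>(-1, 1)\<close> iff it moves inwards and \<open>N * \<bar>\<omega>\<bar> < 2\<close>
  (\<open>ramp_from_sign_bound\<close>). All arms moving inwards forces every \<open>z c\<close> to be \<open>- z1\<close>; then
  \<open>\<bar>\<omega>\<bar> = (K + 1) / bstar\<close>, and the length bounds become those of condition (B)
  (\<open>star_component_feasible_iff\<close>). Jumps keep away from ramification points, so \<open>b1 \<ge> 2\<close> and
  \<open>b c \<ge> 1\<close>, and each arm has a vertex at which \<open>\<bar>W\<bar> < 1\<close> decides its direction.
\<close>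

section \<open>Ancestors and the path matrix\<close>

definition parent_rel :: "nat \<Rightarrow> (nat \<Rightarrow> nat) \<Rightarrow> (nat \<times> nat) set" where
  "parent_rel n pa = {(pa i, i) |i. i \<in> {2..n}}"

abbreviation ancestor :: "nat \<Rightarrow> (nat \<Rightarrow> nat) \<Rightarrow> nat \<Rightarrow> nat \<Rightarrow> bool" where
  "ancestor n pa j k \<equiv> (j, k) \<in> (parent_rel n pa)\<^sup>*"

abbreviation downward :: "nat \<Rightarrow> (nat \<Rightarrow> nat) \<Rightarrow> nat list \<Rightarrow> bool" where
  "downward n pa \<equiv> successively (\<lambda>u v. v \<in> children n pa u)"

lemma parent_bounds:
  assumes "rooted_tree n pa" "i \<in> {2..n}"
  shows "1 \<le> pa i" "pa i < i" "pa i \<in> {1..n}"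
proof -
  show "1 \<le> pa i" "pa i < i"
    using assms unfolding rooted_tree_def by blast+
  then show "pa i \<in> {1..n}"
    using assms(2) by auto
qed

lemma ancestor_le:
  assumes "rooted_tree n pa" "ancestor n pa j k"
  shows "j \<le> k"
  using assms(2)
proof (induction rule: rtrancl_induct)
  case (step y z)
  then show ?case
    using parent_bounds(2)[OF assms(1)] unfolding parent_rel_def by fastforce
qed simp

lemma ancestor_step:
  assumes "i \<in> {2..n}"
  shows "ancestor n pa j i \<longleftrightarrow> j = i \<or> ancestor n pa j (pa i)"
proof
  assume "ancestor n pa j i"
  then show "j = i \<or> ancestor n pa j (pa i)"
    by (cases rule: rtranclE) (auto simp: parent_rel_def)
next
  have "(pa i, i) \<in> parent_rel n pa"
    using assms unfolding parent_rel_def by blast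
  then show "j = i \<or> ancestor n pa j (pa i) \<Longrightarrow> ancestor n pa j i"
    by (auto intro: rtrancl.rtrancl_into_rtrancl)
qed

lemma ancestor_indicator_step:
  assumes "rooted_tree n pa" "i \<in> {2..n}"
  shows "(of_bool (ancestor n pa j i) :: real) = of_bool (j = i) + of_bool (ancestor n pa j (pa i))"
proof -
  have "\<not> ancestor n pa i (pa i)"
    using ancestor_le[OF assms(1)] parent_bounds(2)[OF assms] by fastforce
  then show ?thesis
    unfolding ancestor_step[OF assms(2)] by (cases "j = i") auto
qed

lemma ancestor_root:
  assumes "rooted_tree n pa"
  shows "ancestor n pa j 1 \<longleftrightarrow> j = 1"
proof
  assume "ancestor n pa j 1"
  then show "j = 1"
  proof (cases rule: rtranclE)
    case (step y)
    then show ?thesis by (auto simp: parent_rel_def)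
  qed
qed simp

lemma downward_increasing:
  assumes "rooted_tree n pa" "downward n pa xs"
  shows "sorted_wrt (<) xs"
proof -
  have "successively (<) xs"
    using assms(2) by (rule successively_mono)
      (use parent_bounds(2)[OF assms(1)] in \<open>auto simp: children_def\<close>)
  then show ?thesis
    by (simp add: successively_conv_sorted_wrt transp_def)
qed

lemma downward_vertex_path:
  assumes tree: "rooted_tree n pa" and down: "downward n pa xs"
    and "xs \<noteq> []" "hd xs \<in> {1..n}"
  shows "vertex_path n pa xs"
proof -
  have "distinct xs"
    using downward_increasing[OF tree down] by (simp add: strict_sorted_iff)
  moreover have "successively (adjacent n pa) xs"
    using down by (rule successively_mono) (auto simp: adjacent_def children_def)
  moreover have "set xs \<subseteq> {1..n}"
  proof
    fix u assume "u \<in> set xs"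
    then obtain k where k: "k < length xs" "u = xs ! k"
      by (auto simp: in_set_conv_nth)
    show "u \<in> {1..n}"
    proof (cases k)
      case 0
      then show ?thesis using assms(3,4) k by (simp add: hd_conv_nth)
    next
      case (Suc k')
      then have "xs ! Suc k' \<in> children n pa (xs ! k')"
        using down k by (auto simp: successively_conv_nth)
      then show ?thesis using k Suc by (auto simp: children_def)
    qed
  qed
  ultimately show ?thesis
    using assms(3) unfolding vertex_path_def by blast
qed

text \<open>
  A path that starts at the root and never repeats a vertex cannot turn back: an upward step would
  revisit the vertex it has just come from.
\<close>

lemma path_from_root_downward:
  assumes tree: "rooted_tree n pa" and "vertex_path n pa xs" "hd xs = 1"
  shows "downward n pa xs"
proof -
  have "xs \<noteq> []" "distinct xs" "successively (adjacent n pa) xs"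
    using assms(2) unfolding vertex_path_def by auto
  with assms(3) show ?thesis
  proof (induction xs rule: rev_induct)
    case (snoc v xs)
    show ?case
    proof (cases "xs = []")
      case False
      then obtain ys u where xs: "xs = ys @ [u]"
        by (metis rev_exhaust)
      have dist: "distinct (ys @ [u, v])" and adj: "adjacent n pa u v"
        and path: "successively (adjacent n pa) xs"
        using snoc.prems(3,4) by (simp_all add: xs successively_append_iff)
      have root: "hd xs = 1"
        using snoc.prems(1) False by simp
      have ih: "downward n pa xs"
        using snoc.IH[OF root False _ path] dist by (simp add: xs)
      have "\<not> (u \<in> {2..n} \<and> pa u = v)"
      proof (cases ys rule: rev_cases)
        case Nil
        then show ?thesis using root by (simp add: xs)
      next
        case (snoc zs t)
        then have "u \<in> children n pa t"
          using ih by (simp add: xs successively_append_iff)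
        then show ?thesis using dist snoc by (auto simp: children_def)
      qed
      then have "v \<in> children n pa u"
        using adj by (auto simp: adjacent_def children_def)
      then show ?thesis
        using ih by (simp add: xs successively_append_iff)
    qed simp
  qed simp
qed

lemma set_path_from_root:
  assumes tree: "rooted_tree n pa" and "downward n pa xs" "xs \<noteq> []" "hd xs = 1"
  shows "set xs = {j. ancestor n pa j (last xs)}"
  using assms(2-4)
proof (induction xs rule: rev_induct)
  case (snoc v xs)
  show ?case
  proof (cases "xs = []")
    case True
    then show ?thesis using snoc.prems ancestor_root[OF tree] by auto
  next
    case False
    then have "set xs = {j. ancestor n pa j (last xs)}" "v \<in> children n pa (last xs)"
      using snoc by (auto simp: successively_append_iff)
    then show ?thesis
      using ancestor_step[where i = v and n = n and pa = pa] by (auto simp: children_def)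
  qed
qed simp

lemma path_from_root_exists:
  assumes tree: "rooted_tree n pa"
  shows "i \<in> {1..n} \<Longrightarrow> \<exists>xs. xs \<noteq> [] \<and> downward n pa xs \<and> hd xs = 1 \<and> last xs = i"
proof (induction i rule: less_induct)
  case (less i)
  show ?case
  proof (cases "i = 1")
    case True
    then show ?thesis by (intro exI[of _ "[1]"]) simp
  next
    case False
    then have i: "i \<in> {2..n}" using less.prems by auto
    then obtain xs where "xs \<noteq> []" "downward n pa xs" "hd xs = 1" "last xs = pa i"
      using less.IH parent_bounds[OF tree i] by blast
    then show ?thesis
      using i by (intro exI[of _ "xs @ [i]"]) (auto simp: successively_append_iff children_def)
  qed
qed

lemma path_matrix_index:
  assumes tree: "rooted_tree n pa" and "i < n" "j < n"
  shows "path_matrix n pa $$ (i, j) = of_bool (ancestor n pa (j + 1) (i + 1))"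
proof -
  have "(\<exists>xs. vertex_path n pa xs \<and> hd xs = 1 \<and> last xs = i + 1 \<and> j + 1 \<in> set xs)
      \<longleftrightarrow> ancestor n pa (j + 1) (i + 1)" (is "?L \<longleftrightarrow> ?R")
  proof
    assume ?L
    then obtain xs where xs: "vertex_path n pa xs" "hd xs = 1" "last xs = i + 1" "j + 1 \<in> set xs"
      by blast
    then have "xs \<noteq> []"
      by (auto simp: vertex_path_def)
    from set_path_from_root[OF tree path_from_root_downward[OF tree xs(1,2)] this xs(2)]
    show ?R using xs(3,4) by simp
  next
    assume ?R
    obtain xs where xs: "xs \<noteq> []" "downward n pa xs" "hd xs = 1" "last xs = i + 1"
      using path_from_root_exists[OF tree, of "i + 1"] assms(2) by auto
    moreover have "vertex_path n pa xs"
      using downward_vertex_path[OF tree xs(2,1)] xs(3) assms(2) by auto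
    moreover have "j + 1 \<in> set xs"
      using set_path_from_root[OF tree xs(2,1,3)] xs(4) \<open>?R\<close> by simp
    ultimately show ?L by blast
  qed
  then show ?thesis
    using assms by (simp add: path_matrix_def)
qed

definition subtree_sum :: "nat \<Rightarrow> (nat \<Rightarrow> nat) \<Rightarrow> (nat \<Rightarrow> real) \<Rightarrow> nat \<Rightarrow> real" where
  "subtree_sum n pa w j = (\<Sum>k=1..n. of_bool (ancestor n pa j k) * w k)"

lemma finite_children [simp]: "finite (children n pa v)"
  by (simp add: children_def)

text \<open>
  The subtrees of the children partition the subtree of \<open>j\<close> without \<open>j\<close>. The indicators are
  compared along the path from \<open>k\<close> to the root, where a step to the parent changes both sides alike.
\<close>

lemma subtree_indicator_children:
  assumes tree: "rooted_tree n pa"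
  shows "k \<in> {1..n} \<Longrightarrow> (of_bool (ancestor n pa j k) :: real) =
    of_bool (k = j) + (\<Sum>c\<in>children n pa j. of_bool (ancestor n pa c k))"
proof (induction k rule: less_induct)
  case (less k)
  show ?case
  proof (cases "k = 1")
    case True
    then show ?thesis
      using ancestor_root[OF tree] by (auto simp: children_def intro!: sum.neutral)
  next
    case False
    then have k: "k \<in> {2..n}" using less.prems by auto
    have "(\<Sum>c\<in>children n pa j. of_bool (c = k)) = (of_bool (pa k = j) :: real)"
      using k by (auto simp: children_def of_bool_def sum.delta)
    then have "(\<Sum>c\<in>children n pa j. of_bool (ancestor n pa c k) :: real)
        = of_bool (pa k = j) + (\<Sum>c\<in>children n pa j. of_bool (ancestor n pa c (pa k)))"
      by (simp add: ancestor_indicator_step[OF tree k] sum.distrib)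
    also have "\<dots> = of_bool (ancestor n pa j (pa k))"
      using less.IH[of "pa k"] parent_bounds[OF tree k] by simp
    finally show ?thesis
      using ancestor_indicator_step[OF tree k, of j] by (simp add: eq_commute)
  qed
qed

lemma subtree_sum_children:
  assumes tree: "rooted_tree n pa" and j: "j \<in> {1..n}"
  shows "subtree_sum n pa w j = w j + (\<Sum>c\<in>children n pa j. subtree_sum n pa w c)"
proof -
  have "subtree_sum n pa w j = (\<Sum>k=1..n. of_bool (k = j) * w k
      + (\<Sum>c\<in>children n pa j. of_bool (ancestor n pa c k) * w k))"
    unfolding subtree_sum_def
    by (intro sum.cong refl, subst subtree_indicator_children[OF tree])
      (simp_all add: distrib_right sum_distrib_right)
  also have "\<dots> = (\<Sum>k=1..n. of_bool (k = j) * w k)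
      + (\<Sum>k=1..n. \<Sum>c\<in>children n pa j. of_bool (ancestor n pa c k) * w k)"
    by (rule sum.distrib)
  also have "(\<Sum>k=1..n. \<Sum>c\<in>children n pa j. of_bool (ancestor n pa c k) * w k)
      = (\<Sum>c\<in>children n pa j. subtree_sum n pa w c)"
    unfolding subtree_sum_def by (rule sum.swap)
  also have "(\<Sum>k=1..n. of_bool (k = j) * w k) = (\<Sum>k=1..n. if k = j then w k else 0)"
    by (intro sum.cong) auto
  also have "\<dots> = w j"
    using j by simp
  finally show ?thesis .
qed

lemma subtree_sum_root:
  assumes tree: "rooted_tree n pa"
  shows "subtree_sum n pa w 1 = (\<Sum>k=1..n. w k)"
proof -
  have "ancestor n pa 1 k" if k: "k \<in> {1..n}" for k
  proof -
    obtain xs where xs: "xs \<noteq> []" "downward n pa xs" "hd xs = 1" "last xs = k"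
      using path_from_root_exists[OF tree k] by blast
    then show ?thesis
      using set_path_from_root[OF tree xs(2,1,3)] hd_in_set[OF xs(1)] by simp
  qed
  then show ?thesis by (simp add: subtree_sum_def)
qed

lemma columns_at_carrier:
  "columns_at (path_matrix n pa) T \<in> carrier_mat n (length (sorted_list_of_set T))"
proof -
  have "dim_row (path_matrix n pa) = n"
    by (simp add: path_matrix_def)
  then show ?thesis
    unfolding columns_at_def by (intro carrier_matI) simp_all
qed

lemma columns_at_index:
  assumes tree: "rooted_tree n pa" and T: "T \<subseteq> {2..n}"
    and "i < n" "k < length (sorted_list_of_set T)"
  shows "columns_at (path_matrix n pa) T $$ (i, k)
    = of_bool (ancestor n pa (sorted_list_of_set T ! k) (i + 1))"
proof -
  let ?j = "sorted_list_of_set T ! k"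
  have "?j \<in> T"
    using nth_mem[OF assms(4)] finite_subset[OF T] by simp
  then have "?j \<in> {2..n}"
    using T by blast
  then have j: "?j - 1 < n" "?j - 1 + 1 = ?j"
    by auto
  have "dim_row (path_matrix n pa) = n" "dim_col (path_matrix n pa) = n"
    by (simp_all add: path_matrix_def)
  then have "columns_at (path_matrix n pa) T $$ (i, k) = path_matrix n pa $$ (i, ?j - 1)"
    using assms(3,4) j by (simp add: columns_at_def mat_of_cols_index)
  then show ?thesis
    using path_matrix_index[OF tree assms(3) j(1)] j(2) by simp
qed


section \<open>The irrepresentable condition as a bound on subtree sums\<close>

lemma centering_matrix_carrier [simp]: "centering_matrix n \<in> carrier_mat n n"
  unfolding centering_matrix_def by (intro minus_carrier_mat smult_carrier_mat) (rule mat_carrier)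

lemma mult_mat_vec_sum:
  assumes "A \<in> carrier_mat nr nc" "v \<in> carrier_vec nc" "i < nr"
  shows "vec_index (A *\<^sub>v v) i = (\<Sum>j=0..<nc. A $$ (i, j) * vec_index v j)"
  using assms by (simp add: scalar_prod_def)

lemma centering_matrix_mult:
  assumes "y \<in> carrier_vec n" "i < n"
  shows "vec_index (centering_matrix n *\<^sub>v y) i
    = vec_index y i - (\<Sum>j=0..<n. vec_index y j) / real n"
proof -
  have "vec_index (centering_matrix n *\<^sub>v y) i
      = (\<Sum>j=0..<n. centering_matrix n $$ (i, j) * vec_index y j)"
    by (rule mult_mat_vec_sum[OF centering_matrix_carrier assms])
  also have "\<dots> = (\<Sum>j=0..<n. (if j = i then vec_index y j else 0) - vec_index y j / real n)"
  proof (intro sum.cong refl)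
    fix j assume "j \<in> {0..<n}"
    then have "centering_matrix n $$ (i, j) = of_bool (j = i) - 1 / real n"
      using assms(2) by (simp add: centering_matrix_def)
    then show "centering_matrix n $$ (i, j) * vec_index y j
        = (if j = i then vec_index y j else 0) - vec_index y j / real n"
      by (cases "j = i") (simp_all add: left_diff_distrib)
  qed
  also have "\<dots> = (\<Sum>j=0..<n. if j = i then vec_index y j else 0) - (\<Sum>j=0..<n. vec_index y j / real n)"
    by (rule sum_subtractf)
  also have "\<dots> = vec_index y i - (\<Sum>j=0..<n. vec_index y j) / real n"
    unfolding sum_divide_distrib[symmetric] using assms(2) by simp
  finally show ?thesis .
qed

lemma sum_centered_eq_0:
  assumes "y \<in> carrier_vec n"
  shows "(\<Sum>i=0..<n. vec_index (centering_matrix n *\<^sub>v y) i) = 0"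
proof -
  have "(\<Sum>i=0..<n. vec_index (centering_matrix n *\<^sub>v y) i)
      = (\<Sum>i=0..<n. vec_index y i - (\<Sum>j=0..<n. vec_index y j) / real n)"
    by (intro sum.cong refl centering_matrix_mult[OF assms]) simp
  also have "\<dots> = 0"
    unfolding sum_subtractf by (cases "n = 0") simp_all
  finally show ?thesis .
qed

lemma sum_vertices_shift: "(\<Sum>i=0..<n. f (i + 1)) = (\<Sum>k=1..n. f k)" for f :: "nat \<Rightarrow> real"
  by (simp add: sum.atLeast1_atMost_eq lessThan_atLeast0)

lemma transpose_columns_mult:
  assumes tree: "rooted_tree n pa" and T: "T \<subseteq> {2..n}"
    and w: "w \<in> carrier_vec n" and k: "k < length (sorted_list_of_set T)"
  shows "vec_index (transpose_mat (columns_at (path_matrix n pa) T) *\<^sub>v w) k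
    = subtree_sum n pa (\<lambda>i. vec_index w (i - 1)) (sorted_list_of_set T ! k)"
proof -
  let ?B = "columns_at (path_matrix n pa) T" and ?s = "sorted_list_of_set T"
  have B: "?B \<in> carrier_mat n (length ?s)"
    by (rule columns_at_carrier)
  then have "vec_index (transpose_mat ?B *\<^sub>v w) k
      = (\<Sum>i=0..<n. transpose_mat ?B $$ (k, i) * vec_index w i)"
    using w k by (intro mult_mat_vec_sum[of _ "length ?s"]) auto
  also have "\<dots> = (\<Sum>i=0..<n. of_bool (ancestor n pa (?s ! k) (i + 1)) * vec_index w (i + 1 - 1))"
    using B k by (intro sum.cong refl) (simp add: columns_at_index[OF tree T])
  also have "\<dots> = subtree_sum n pa (\<lambda>i. vec_index w (i - 1)) (?s ! k)"
    unfolding subtree_sum_def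
    by (rule sum_vertices_shift[of "\<lambda>k'. of_bool (ancestor n pa (?s ! k) k') * vec_index w (k' - 1)"])
  finally show ?thesis .
qed

text \<open>
  Along an edge the columns of the path matrix change in exactly one place: only the column that
  belongs to this edge distinguishes its two ends.
\<close>

lemma columns_mult_edge_diff:
  assumes tree: "rooted_tree n pa" and T: "T \<subseteq> {2..n}"
    and v: "v \<in> carrier_vec (length (sorted_list_of_set T))" and i: "i \<in> {2..n}"
  shows "vec_index (columns_at (path_matrix n pa) T *\<^sub>v v) (i - 1)
      - vec_index (columns_at (path_matrix n pa) T *\<^sub>v v) (pa i - 1)
    = (\<Sum>k=0..<length (sorted_list_of_set T). of_bool (sorted_list_of_set T ! k = i) * vec_index v k)"
proof -
  let ?B = "columns_at (path_matrix n pa) T" and ?s = "sorted_list_of_set T"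
  have expand: "vec_index (?B *\<^sub>v v) (u - 1)
      = (\<Sum>k=0..<length ?s. of_bool (ancestor n pa (?s ! k) u) * vec_index v k)"
    if u: "u \<in> {1..n}" for u
  proof -
    have u': "u - 1 < n" "u - 1 + 1 = u"
      using u by auto
    then have "vec_index (?B *\<^sub>v v) (u - 1)
        = (\<Sum>k=0..<length ?s. ?B $$ (u - 1, k) * vec_index v k)"
      by (intro mult_mat_vec_sum[OF columns_at_carrier v])
    then show ?thesis
      using columns_at_index[OF tree T u'(1)] u'(2) by simp
  qed
  have "i \<in> {1..n}"
    using i by auto
  then show ?thesis
    by (simp only: expand parent_bounds(3)[OF tree i] ancestor_indicator_step[OF tree i]
        distrib_right sum.distrib add_diff_cancel_right')
qed

lemma sum_unique_index:
  fixes v :: "real Matrix.vec"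
  assumes "distinct s" "k < length s"
  shows "(\<Sum>k'=0..<length s. of_bool (s ! k' = s ! k) * vec_index v k') = vec_index v k"
proof -
  have "(\<Sum>k'=0..<length s. of_bool (s ! k' = s ! k) * vec_index v k')
      = (\<Sum>k'=0..<length s. if k' = k then vec_index v k' else 0)"
    using assms by (intro sum.cong refl) (auto simp: nth_eq_iff_index_eq)
  then show ?thesis using assms(2) by simp
qed

text \<open>
  The Gram matrix of the centred jump columns is nonsingular. If it kills \<open>v\<close>, the centred signal
  \<open>w\<close> is orthogonal to the uncentred signal \<open>y\<close> and to the constants, so \<open>w = 0\<close> and \<open>y\<close> is constant.
  The entries of \<open>v\<close> are the jumps of \<open>y\<close> and hence zero.
\<close>

lemma gram_kernel_trivial:
  fixes S :: "nat set"
  defines "m \<equiv> length (sorted_list_of_set S)"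
  assumes tree: "rooted_tree n pa" and S: "S \<subseteq> {2..n}" and v: "v \<in> carrier_vec m"
    and zero: "transpose_mat (columns_at (path_matrix n pa) S) *\<^sub>v
      (centering_matrix n *\<^sub>v (columns_at (path_matrix n pa) S *\<^sub>v v)) = 0\<^sub>v m"
  shows "v = 0\<^sub>v m"
proof -
  let ?B = "columns_at (path_matrix n pa) S" and ?s = "sorted_list_of_set S"
  define y where "y = ?B *\<^sub>v v"
  define w where "w = centering_matrix n *\<^sub>v y"
  define mean where "mean = (\<Sum>j=0..<n. vec_index y j) / real n"
  have B: "?B \<in> carrier_mat n m"
    unfolding m_def by (rule columns_at_carrier)
  have y: "y \<in> carrier_vec n"
    unfolding y_def using B v by simp
  have w: "w \<in> carrier_vec n"
    unfolding w_def by (rule mult_mat_vec_carrier[OF centering_matrix_carrier y])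
  have wi: "vec_index w i = vec_index y i - mean" if "i < n" for i
    unfolding w_def mean_def by (rule centering_matrix_mult[OF y that])
  have "scalar_prod w y = scalar_prod (transpose_mat ?B *\<^sub>v w) v"
    unfolding y_def using transpose_vec_mult_scalar[OF B v w] by simp
  also have "\<dots> = 0"
    using zero v by (simp add: w_def y_def)
  finally have "(\<Sum>i=0..<n. vec_index w i * vec_index y i) = 0"
    using y by (simp add: scalar_prod_def)
  moreover have "(\<Sum>i=0..<n. vec_index w i) = 0"
    unfolding w_def by (rule sum_centered_eq_0[OF y])
  moreover have "(\<Sum>i=0..<n. (vec_index w i)\<^sup>2)
      = (\<Sum>i=0..<n. vec_index w i * vec_index y i) - mean * (\<Sum>i=0..<n. vec_index w i)"
    unfolding sum_distrib_left sum_subtractf[symmetric]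
    by (intro sum.cong refl) (simp add: wi power2_eq_square algebra_simps)
  ultimately have "(\<Sum>i=0..<n. (vec_index w i)\<^sup>2) = 0"
    by simp
  then have "\<forall>i\<in>{0..<n}. (vec_index w i)\<^sup>2 = 0"
    by (subst (asm) sum_nonneg_eq_0_iff) auto
  then have const: "vec_index y i = mean" if "i < n" for i
    using wi that by simp
  show ?thesis
  proof (intro eq_vecI)
    fix k assume "k < dim_vec (0\<^sub>v m :: real Matrix.vec)"
    then have k: "k < length ?s"
      by (simp add: m_def)
    then have "?s ! k \<in> S"
      using nth_mem[OF k] finite_subset[OF S] by simp
    then have i: "?s ! k \<in> {2..n}"
      using S by blast
    have "vec_index v k
        = (\<Sum>k'=0..<length ?s. of_bool (?s ! k' = ?s ! k) * vec_index v k')"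
      by (rule sum_unique_index[OF distinct_sorted_list_of_set k, symmetric])
    also have "\<dots> = vec_index y (?s ! k - 1) - vec_index y (pa (?s ! k) - 1)"
      unfolding y_def by (rule columns_mult_edge_diff[OF tree S v[unfolded m_def] i, symmetric])
    also have "\<dots> = 0"
    proof -
      have "?s ! k - 1 < n" "pa (?s ! k) - 1 < n"
        using i parent_bounds[OF tree i] by auto
      then show ?thesis by (simp add: const)
    qed
    finally show "vec_index v k = vec_index (0\<^sub>v m) k"
      using k by (simp add: m_def)
  qed (use v in simp)
qed

lemma sup_norm_vec_less_1_iff:
  "(\<exists>\<eta>. 0 < \<eta> \<and> \<eta> \<le> 1 \<and> sup_norm_vec v \<le> 1 - \<eta>) \<longleftrightarrow> (\<forall>i<dim_vec v. \<bar>vec_index v i\<bar> < 1)"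
proof -
  have "(\<exists>\<eta>. 0 < \<eta> \<and> \<eta> \<le> 1 \<and> sup_norm_vec v \<le> 1 - \<eta>) \<longleftrightarrow> sup_norm_vec v < 1"
  proof
    assume "sup_norm_vec v < 1"
    moreover have "0 \<le> sup_norm_vec v"
      unfolding sup_norm_vec_def by (intro Max_ge) auto
    ultimately show "\<exists>\<eta>. 0 < \<eta> \<and> \<eta> \<le> 1 \<and> sup_norm_vec v \<le> 1 - \<eta>"
      by (intro exI[of _ "1 - sup_norm_vec v"]) simp
  qed auto
  also have "\<dots> \<longleftrightarrow> (\<forall>i<dim_vec v. \<bar>vec_index v i\<bar> < 1)"
    unfolding sup_norm_vec_def by (subst Max_less_iff) auto
  finally show ?thesis .
qed

text \<open>
  The vector obtained here is \<open>A\<^sub>1 X\<^sub>S G\<inverse> z\<close>. Centring makes its total zero; being a combination of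
  jump columns up to a constant, it only changes across jumps; and \<open>X\<^sub>S'\<close> maps it
  to \<open>G G\<inverse> z = z\<close>, which prescribes its subtree sums at the jumps.
\<close>

lemma irrepresentable_condition_profile:
  fixes f0 :: "nat \<Rightarrow> real"
  assumes tree: "rooted_tree n pa"
  defines "S \<equiv> true_jumps n pa f0"
  obtains w where
    "\<And>i. i \<in> {2..n} - S \<Longrightarrow> w i = w (pa i)"
    "subtree_sum n pa w 1 = 0"
    "\<And>j. j \<in> S \<Longrightarrow> subtree_sum n pa w j = jump_sgn pa f0 j"
    "irrepresentable_condition n pa f0 \<longleftrightarrow> (\<forall>i\<in>{2..n} - S. \<bar>subtree_sum n pa w i\<bar> < 1)"
proof -
  let ?s = "sorted_list_of_set S" and ?r = "sorted_list_of_set ({2..n} - S)"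
  define m where "m = length ?s"
  define B where "B = columns_at (path_matrix n pa) S"
  define BR where "BR = columns_at (path_matrix n pa) ({2..n} - S)"
  define A where "A = centering_matrix n"
  define z where "z = vec_of_list (map (jump_sgn pa f0) ?s)"
  define G where "G = transpose_mat B * A * B"
  have S: "S \<subseteq> {2..n}"
    unfolding S_def true_jumps_def by auto
  have R: "{2..n} - S \<subseteq> {2..n}" by auto
  have B: "B \<in> carrier_mat n m"
    unfolding B_def m_def by (rule columns_at_carrier)
  have BR: "BR \<in> carrier_mat n (length ?r)"
    unfolding BR_def by (rule columns_at_carrier)
  have A: "A \<in> carrier_mat n n"
    unfolding A_def by simp
  have z: "z \<in> carrier_vec m"
    unfolding z_def m_def by (intro carrier_vecI) simp
  have G: "G \<in> carrier_mat m m"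
    unfolding G_def using A B by simp
  \<comment> \<open>Matrix products are applied to vectors from right to left so that only \<open>w\<close> appears.\<close>
  have G_mult: "G *\<^sub>v v = transpose_mat B *\<^sub>v (A *\<^sub>v (B *\<^sub>v v))" if v: "v \<in> carrier_vec m" for v
  proof -
    have "G *\<^sub>v v = (transpose_mat B * A) *\<^sub>v (B *\<^sub>v v)"
      unfolding G_def using A B v by (intro assoc_mult_mat_vec[of _ m n _ m]) auto
    also have "\<dots> = transpose_mat B *\<^sub>v (A *\<^sub>v (B *\<^sub>v v))"
      using A B v by (intro assoc_mult_mat_vec[of _ m n _ n]) auto
    finally show ?thesis .
  qed
  have "\<not> (\<exists>v. v \<in> carrier_vec m \<and> v \<noteq> 0\<^sub>v m \<and> G *\<^sub>v v = 0\<^sub>v m)"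
  proof
    assume "\<exists>v. v \<in> carrier_vec m \<and> v \<noteq> 0\<^sub>v m \<and> G *\<^sub>v v = 0\<^sub>v m"
    then obtain v where v: "v \<in> carrier_vec m" "v \<noteq> 0\<^sub>v m" "G *\<^sub>v v = 0\<^sub>v m"
      by blast
    then have "v = 0\<^sub>v m"
      using gram_kernel_trivial[OF tree S, of v] G_mult[OF v(1)]
      by (simp add: m_def A_def B_def)
    with v(2) show False ..
  qed
  then have "Determinant.det G \<noteq> 0"
    using det_0_iff_vec_prod_zero_field[OF G] by blast
  then have "G \<in> Units (ring_mat TYPE(real) m ())"
    by (rule det_non_zero_imp_unit[OF G])
  then obtain H where H: "mat_inverse G = Some H"
    using mat_inverse(1)[OF G] by fastforce
  have H': "G * H = 1\<^sub>m m" "H \<in> carrier_mat m m"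
    using mat_inverse(2)[OF G H] by auto
  define w where "w = A *\<^sub>v (B *\<^sub>v (H *\<^sub>v z))"
  have Hz: "H *\<^sub>v z \<in> carrier_vec m"
    using H'(2) z by simp
  then have Bz: "B *\<^sub>v (H *\<^sub>v z) \<in> carrier_vec n"
    using B by simp
  then have w: "w \<in> carrier_vec n"
    unfolding w_def using A by simp
  have "transpose_mat B *\<^sub>v w = G *\<^sub>v (H *\<^sub>v z)"
    unfolding w_def using G_mult[OF Hz] by simp
  also have "\<dots> = (G * H) *\<^sub>v z"
    using assoc_mult_mat_vec[OF G H'(2) z] by simp
  also have "\<dots> = z"
    using H'(1) z by simp
  finally have Bw: "transpose_mat B *\<^sub>v w = z" .
  have "(transpose_mat BR * A * B * H) *\<^sub>v z = (transpose_mat BR * A * B) *\<^sub>v (H *\<^sub>v z)"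
    using BR A B H'(2) z by (intro assoc_mult_mat_vec[of _ "length ?r" m _ m]) auto
  also have "\<dots> = (transpose_mat BR * A) *\<^sub>v (B *\<^sub>v (H *\<^sub>v z))"
    using BR A B Hz by (intro assoc_mult_mat_vec[of _ "length ?r" n _ m]) auto
  also have "\<dots> = transpose_mat BR *\<^sub>v w"
    unfolding w_def
    using BR A Bz by (intro assoc_mult_mat_vec[of _ "length ?r" n _ n]) auto
  finally have R_prod: "(transpose_mat BR * A * B * H) *\<^sub>v z = transpose_mat BR *\<^sub>v w" .
  let ?w = "\<lambda>i. vec_index w (i - 1)"
  show ?thesis
  proof
    show "?w i = ?w (pa i)" if i: "i \<in> {2..n} - S" for i
    proof -
      have i': "i \<in> {2..n}" "i \<notin> S" using i by auto
      have "vec_index (B *\<^sub>v (H *\<^sub>v z)) (i - 1) - vec_index (B *\<^sub>v (H *\<^sub>v z)) (pa i - 1)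
          = (\<Sum>k=0..<length ?s. of_bool (?s ! k = i) * vec_index (H *\<^sub>v z) k)"
        unfolding B_def using Hz
        by (intro columns_mult_edge_diff[OF tree S _ i'(1)]) (simp add: m_def)
      also have "\<dots> = 0"
      proof (intro sum.neutral ballI)
        fix k assume "k \<in> {0..<length ?s}"
        then have "?s ! k \<in> S"
          using nth_mem[of k ?s] finite_subset[OF S] by simp
        then show "of_bool (?s ! k = i) * vec_index (H *\<^sub>v z) k = 0"
          using i'(2) by auto
      qed
      finally have "vec_index (B *\<^sub>v (H *\<^sub>v z)) (i - 1) = vec_index (B *\<^sub>v (H *\<^sub>v z)) (pa i - 1)"
        by simp
      moreover have "i - 1 < n" "pa i - 1 < n"
        using i' parent_bounds[OF tree i'(1)] by auto
      ultimately show ?thesis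
        unfolding w_def A_def using Bz by (simp add: centering_matrix_mult)
    qed
  next
    have "subtree_sum n pa ?w 1 = (\<Sum>i=0..<n. vec_index w (i + 1 - 1))"
      unfolding subtree_sum_root[OF tree]
      by (rule sum_vertices_shift[of ?w, symmetric])
    also have "\<dots> = 0"
      using sum_centered_eq_0[OF Bz] by (simp add: w_def A_def)
    finally show "subtree_sum n pa ?w 1 = 0" .
  next
    fix j assume "j \<in> S"
    then obtain k where k: "k < length ?s" "?s ! k = j"
      using finite_subset[OF S] by (metis finite_atLeastAtMost in_set_conv_nth set_sorted_list_of_set)
    have "subtree_sum n pa ?w (?s ! k) = vec_index z k"
      using transpose_columns_mult[OF tree S w k(1)] Bw by (simp add: B_def)
    then show "subtree_sum n pa ?w j = jump_sgn pa f0 j"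
      using k by (simp add: z_def vec_of_list_index)
  next
    have "irrepresentable_condition n pa f0 \<longleftrightarrow>
        (\<exists>\<eta>. 0 < \<eta> \<and> \<eta> \<le> 1 \<and> sup_norm_vec (transpose_mat BR *\<^sub>v w) \<le> 1 - \<eta>)"
      unfolding irrepresentable_condition_def Let_def R_prod[symmetric]
      unfolding S_def[symmetric] B_def[symmetric] BR_def[symmetric] A_def[symmetric]
        z_def[symmetric] G_def[symmetric] H option.sel ..
    also have "\<dots> \<longleftrightarrow> (\<forall>k<length ?r. \<bar>vec_index (transpose_mat BR *\<^sub>v w) k\<bar> < 1)"
      unfolding sup_norm_vec_less_1_iff using BR by simp
    also have "\<dots> \<longleftrightarrow> (\<forall>k<length ?r. \<bar>subtree_sum n pa ?w (?r ! k)\<bar> < 1)"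
      using transpose_columns_mult[OF tree R w] by (simp add: BR_def)
    also have "\<dots> \<longleftrightarrow> (\<forall>i\<in>set ?r. \<bar>subtree_sum n pa ?w i\<bar> < 1)"
      unfolding all_set_conv_all_nth ..
    finally show "irrepresentable_condition n pa f0 \<longleftrightarrow>
        (\<forall>i\<in>{2..n} - S. \<bar>subtree_sum n pa ?w i\<bar> < 1)"
      by simp
  qed
qed


section \<open>Jumps in a large enough tree\<close>

text \<open>
  The bounds on neighbouring differences chain up to all pairs, since the gap relation is
  transitive. A truncated difference of at least four is a genuine one.
\<close>

lemma segment_lengths_spread:
  assumes "\<forall>d\<in>set (segment_lengths S xs). 4 \<le> d"
  shows "sorted_wrt (\<lambda>a b. a + 4 \<le> b)
    (0 # filter (\<lambda>k. max (xs ! (k - 1)) (xs ! k) \<in> S) [1..<length xs] @ [length xs])"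
    (is "sorted_wrt ?gap ?bounds")
proof -
  have "successively ?gap ?bounds"
    unfolding successively_conv_nth
  proof (intro allI impI)
    fix j assume j: "Suc j < length ?bounds"
    then have "?bounds ! Suc j - ?bounds ! j \<in> set (segment_lengths S xs)"
      unfolding segment_lengths_def Let_def set_map by (intro imageI) (auto simp: less_Suc_eq)
    then have "4 \<le> ?bounds ! Suc j - ?bounds ! j"
      using assms by blast
    then show "?bounds ! j + 4 \<le> ?bounds ! Suc j"
      by linarith
  qed
  moreover have "transp ?gap"
    by (auto simp: transp_def)
  ultimately show ?thesis
    using successively_conv_sorted_wrt by blast
qed

lemma sorted_wrt_pair:
  assumes "sorted_wrt R xs" "a \<in> set xs" "b \<in> set xs" "a \<noteq> b"
  shows "R a b \<or> R b a"
  using assms by (induction xs) auto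

lemma long_segments_cut:
  assumes "\<forall>d\<in>set (segment_lengths S xs). 4 \<le> d"
    and k: "1 \<le> k" "k < length xs" "max (xs ! (k - 1)) (xs ! k) \<in> S"
  shows "4 \<le> k" "k + 4 \<le> length xs"
    and "\<And>l. 1 \<le> l \<Longrightarrow> l < length xs \<Longrightarrow> max (xs ! (l - 1)) (xs ! l) \<in> S \<Longrightarrow> l \<noteq> k \<Longrightarrow>
      l + 4 \<le> k \<or> k + 4 \<le> l"
proof -
  let ?cuts = "filter (\<lambda>k. max (xs ! (k - 1)) (xs ! k) \<in> S) [1..<length xs]"
  have spread: "sorted_wrt (\<lambda>a b. a + 4 \<le> b) (0 # ?cuts @ [length xs])"
    by (rule segment_lengths_spread[OF assms(1)])
  have cut: "l \<in> set ?cuts" if "1 \<le> l" "l < length xs" "max (xs ! (l - 1)) (xs ! l) \<in> S" for l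
    unfolding set_filter set_upt using that by auto
  have "\<forall>b\<in>set (?cuts @ [length xs]). 0 + 4 \<le> b"
    using spread unfolding sorted_wrt.simps by blast
  then show "4 \<le> k"
    using cut[OF k] by fastforce
  have "\<forall>a\<in>set ?cuts. \<forall>b\<in>set [length xs]. a + 4 \<le> b"
    using spread unfolding sorted_wrt.simps sorted_wrt_append by blast
  then show "k + 4 \<le> length xs"
    using cut[OF k] by fastforce
  show "l + 4 \<le> k \<or> k + 4 \<le> l"
    if "1 \<le> l" "l < length xs" "max (xs ! (l - 1)) (xs ! l) \<in> S" "l \<noteq> k" for l
  proof -
    have "sorted_wrt (\<lambda>a b. a + 4 \<le> b) ?cuts"
      using spread unfolding sorted_wrt.simps sorted_wrt_append by blast
    from sorted_wrt_pair[OF this cut[OF that(1-3)] cut[OF k] that(4)]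
    show ?thesis .
  qed
qed

lemma vertex_degree_nonroot:
  assumes tree: "rooted_tree n pa" and v: "v \<in> {2..n}"
  shows "vertex_degree n pa v = card (children n pa v) + 1"
proof -
  have "{u \<in> {1..n}. adjacent n pa u v} = insert (pa v) (children n pa v)"
    using v parent_bounds(3)[OF tree v] by (auto simp: adjacent_def children_def)
  moreover have "pa v \<notin> children n pa v"
  proof
    assume "pa v \<in> children n pa v"
    then have "pa v \<in> {2..n}" "pa (pa v) = v"
      by (simp_all add: children_def)
    then show False
      using parent_bounds(2)[OF tree, of "pa v"] parent_bounds(2)[OF tree v] by simp
  qed
  ultimately show ?thesis
    unfolding vertex_degree_def by simp
qed

lemma vertex_degree_root:
  assumes tree: "rooted_tree n pa"
  shows "vertex_degree n pa 1 = card (children n pa 1)"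
proof -
  have "{u \<in> {1..n}. adjacent n pa u 1} = children n pa 1"
    by (auto simp: adjacent_def children_def)
  then show ?thesis
    unfolding vertex_degree_def by simp
qed

text \<open>
  A jump is never a removed edge, so it lies on one of the paths of the decomposition, with at least
  four vertices of the path on either side. Its endpoints are therefore interior vertices of that
  path. Removed edges only touch extremities, so an endpoint \<open>x\<close> has no edges apart from its two path
  edges, and the one that is not \<open>e\<close> is too close to \<open>e\<close> to be a jump.
\<close>

lemma large_enough_neighbours:
  assumes tree: "rooted_tree n pa" and large: "large_enough n pa S"
    and e: "e \<in> S" "e \<in> {2..n}" and x: "x = e \<or> x = pa e"
  obtains a b where "{u \<in> {1..n}. adjacent n pa u x} \<subseteq> {a, b}"
    "\<And>u. adjacent n pa u x \<Longrightarrow> max u x \<in> S \<Longrightarrow> max u x = e"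
proof -
  obtain P C where P: "\<forall>xs\<in>P. vertex_path n pa xs"
    and disj: "pairwise (\<lambda>xs ys. disjnt (set xs) (set ys)) P"
    and C: "C \<subseteq> {2..n} - S"
    and kept: "{2..n} - C = (\<Union>xs\<in>P. path_edges xs)"
    and removed: "\<forall>e\<in>C. \<exists>xs\<in>P. \<exists>ys\<in>P. xs \<noteq> ys \<and>
            pa e \<in> {hd xs, last xs} \<and> e \<in> {hd ys, last ys}"
    and long: "\<forall>xs\<in>P. \<forall>d\<in>set (segment_lengths S xs). 4 \<le> d"
    using large unfolding large_enough_def by (elim exE conjE) (rule that; assumption)
  have nonempty: "xs \<noteq> []" if "xs \<in> P" for xs
    using P that by (auto simp: vertex_path_def)
  have same_path: "ys = xs" if "xs \<in> P" "ys \<in> P" "u \<in> set xs" "u \<in> set ys" for xs ys u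
    using disj that by (auto simp: pairwise_def disjnt_def)
  have adj_edge: "{u, v} = {pa (max u v), max u v} \<and> max u v \<in> {2..n}"
    if "adjacent n pa u v" for u v
    using that unfolding adjacent_def
  proof
    assume "v \<in> {2..n} \<and> pa v = u"
    then have "max u v = v" "pa v = u" "v \<in> {2..n}"
      using parent_bounds(2)[OF tree, of v] by auto
    then show ?thesis by simp
  next
    assume "u \<in> {2..n} \<and> pa u = v"
    then have "max u v = u" "pa u = v" "u \<in> {2..n}"
      using parent_bounds(2)[OF tree, of u] by auto
    then show ?thesis by (simp add: insert_commute)
  qed
  from e C kept obtain xs where xs: "xs \<in> P" "e \<in> path_edges xs"
    by blast
  then obtain k' where k': "Suc k' < length xs" "e = max (xs ! k') (xs ! Suc k')"
    unfolding path_edges_def by blast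
  define k where "k = Suc k'"
  have k: "1 \<le> k" "k < length xs" "max (xs ! (k - 1)) (xs ! k) = e"
    using k' by (simp_all add: k_def)
  have long_xs: "\<forall>d\<in>set (segment_lengths S xs). 4 \<le> d"
    using long xs(1) by blast
  have k4: "4 \<le> k" "k + 4 \<le> length xs"
    using long_segments_cut(1,2)[OF long_xs k(1,2)] k(3) e(1) by simp_all
  have gap: "l + 4 \<le> k \<or> k + 4 \<le> l"
    if "1 \<le> l" "l < length xs" "max (xs ! (l - 1)) (xs ! l) \<in> S" "l \<noteq> k" for l
    using long_segments_cut(3)[OF long_xs k(1,2) _ that] k(3) e(1) by blast
  have dist: "distinct xs"
    using P xs(1) by (auto simp: vertex_path_def)
  have adj_k: "adjacent n pa (xs ! (k - 1)) (xs ! k)"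
    using P xs(1) k by (auto simp: vertex_path_def successively_conv_nth dest!: spec[of _ "k - 1"])
  have "x \<in> {xs ! (k - 1), xs ! k}"
    using adj_edge[OF adj_k] k(3) x by auto
  then obtain p where p: "x = xs ! p" "p = k - 1 \<or> p = k"
    by blast
  have p_len: "0 < p" "Suc p < length xs"
    using p(2) k4 by auto
  have interior: "x \<notin> {hd ys, last ys}" if ys: "ys \<in> P" for ys
  proof
    assume extremity: "x \<in> {hd ys, last ys}"
    then have "x \<in> set ys"
      using nonempty[OF ys] by auto
    moreover have "x \<in> set xs"
      using p p_len by simp
    ultimately have "ys = xs"
      using same_path[OF xs(1) ys] by blast
    have hd: "hd xs = xs ! 0" and last: "last xs = xs ! (length xs - 1)"
      using nonempty[OF xs(1)] by (rule hd_conv_nth, rule last_conv_nth)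
    have "x = xs ! 0 \<or> x = xs ! (length xs - 1)"
      using extremity unfolding \<open>ys = xs\<close> hd last by blast
    then show False
    proof
      assume "x = xs ! 0"
      then have eq: "xs ! p = xs ! 0"
        by (rule trans[OF p(1)[symmetric]])
      have "p < length xs" "0 < length xs"
        using p_len by linarith+
      then have "p = 0"
        using nth_eq_iff_index_eq[OF dist] eq by blast
      then show False using p_len by simp
    next
      assume "x = xs ! (length xs - 1)"
      then have eq: "xs ! p = xs ! (length xs - 1)"
        by (rule trans[OF p(1)[symmetric]])
      have "p < length xs" "length xs - 1 < length xs"
        using p_len by linarith+
      then have "p = length xs - 1"
        using nth_eq_iff_index_eq[OF dist] eq by blast
      then show False using p_len by simp
    qed
  qed
  have neighbour: "\<exists>l. (l = p \<or> l = Suc p) \<and> max u x = max (xs ! (l - 1)) (xs ! l)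
      \<and> (u = xs ! (p - 1) \<or> u = xs ! Suc p)"
    if adj: "adjacent n pa u x" for u
  proof -
    define d where "d = max u x"
    have d: "{u, x} = {pa d, d}" "d \<in> {2..n}"
      using adj_edge[OF adj] by (auto simp: d_def)
    have "d \<notin> C"
    proof
      assume "d \<in> C"
      then obtain ys zs where "ys \<in> P" "pa d \<in> {hd ys, last ys}" "zs \<in> P" "d \<in> {hd zs, last zs}"
        using removed by blast
      moreover have "x = pa d \<or> x = d"
        using d(1) by blast
      ultimately show False
        using interior[of ys] interior[of zs] by blast
    qed
    then obtain ys where ys: "ys \<in> P" "d \<in> path_edges ys"
      using kept d(2) by blast
    then obtain l where l: "Suc l < length ys" "d = max (ys ! l) (ys ! Suc l)"
      unfolding path_edges_def by blast
    have "adjacent n pa (ys ! l) (ys ! Suc l)"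
      using P ys(1) l(1) by (auto simp: vertex_path_def successively_conv_nth)
    from adj_edge[OF this] d(1) l(2) have ends: "{ys ! l, ys ! Suc l} = {u, x}"
      by simp
    then have "x = ys ! l \<or> x = ys ! Suc l"
      by blast
    then have "x \<in> set ys"
      using nth_mem[of l ys] nth_mem[OF l(1)] l(1) by (elim disjE) simp_all
    moreover have "x \<in> set xs"
      using p p_len by simp
    ultimately have "ys = xs"
      using same_path[OF xs(1) ys(1)] by blast
    have "l = p \<or> Suc l = p"
    proof -
      have "xs ! p = xs ! l \<or> xs ! p = xs ! Suc l"
        using ends unfolding p(1)[symmetric] \<open>ys = xs\<close> by blast
      then show ?thesis
        using nth_eq_iff_index_eq[OF dist, of p l] nth_eq_iff_index_eq[OF dist, of p "Suc l"]
          l(1) p_len \<open>ys = xs\<close> by (elim disjE) simp_all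
    qed
    have edge: "max u x = max (xs ! (Suc l - 1)) (xs ! Suc l)"
      using l(2) unfolding d_def \<open>ys = xs\<close> diff_Suc_1 .
    from \<open>l = p \<or> Suc l = p\<close> show ?thesis
    proof
      assume "l = p"
      then have "{x, xs ! Suc p} = {u, x}"
        using ends p(1) \<open>ys = xs\<close> by simp
      then have "u = xs ! Suc p"
        unfolding doubleton_eq_iff by blast
      then show ?thesis
        using edge unfolding \<open>l = p\<close> by blast
    next
      assume "Suc l = p"
      then have "{xs ! (p - 1), x} = {u, x}"
        using ends p(1) \<open>ys = xs\<close> by fastforce
      then have "u = xs ! (p - 1)"
        unfolding doubleton_eq_iff by blast
      then show ?thesis
        using edge unfolding \<open>Suc l = p\<close> by blast
    qed
  qed
  show ?thesis
  proof
    show "{u \<in> {1..n}. adjacent n pa u x} \<subseteq> {xs ! (p - 1), xs ! Suc p}"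
      using neighbour by blast
    show "max u x = e" if adj: "adjacent n pa u x" and S: "max u x \<in> S" for u
    proof -
      obtain l where l: "l = p \<or> l = Suc p" "max u x = max (xs ! (l - 1)) (xs ! l)"
        using neighbour[OF adj] by blast
      have "1 \<le> l" "l < length xs"
        using l(1) p_len by linarith+
      then have "l = k"
        using gap[of l] S l p(2) k4(1) unfolding l(2) by linarith
      then show ?thesis
        unfolding l(2) using k(3) by simp
    qed
  qed
qed

lemma large_enough_jump_isolated:
  assumes tree: "rooted_tree n pa" and large: "large_enough n pa S"
    and e: "e \<in> S" "e \<in> {2..n}"
  shows "\<not> ramification_point n pa e" "\<not> ramification_point n pa (pa e)"
    and "pa e \<in> {2..n} \<Longrightarrow> pa e \<notin> S"
proof -
  have deg: "\<not> ramification_point n pa x" if x: "x = e \<or> x = pa e" for x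
  proof -
    obtain a b where "{u \<in> {1..n}. adjacent n pa u x} \<subseteq> {a, b}"
      using large_enough_neighbours[OF tree large e x] by metis
    then have "vertex_degree n pa x \<le> card {a, b}"
      unfolding vertex_degree_def by (intro card_mono) auto
    also have "\<dots> \<le> 2"
      by (simp add: card_insert_if)
    finally show ?thesis
      by (simp add: ramification_point_def)
  qed
  show "\<not> ramification_point n pa e" "\<not> ramification_point n pa (pa e)"
    using deg by blast+
  show "pa e \<notin> S" if "pa e \<in> {2..n}"
  proof
    assume "pa e \<in> S"
    have "adjacent n pa (pa (pa e)) (pa e)" "max (pa (pa e)) (pa e) = pa e" "pa e \<noteq> e"
      using that parent_bounds(2)[OF tree that] parent_bounds(2)[OF tree e(2)]
      by (auto simp: adjacent_def)
    moreover obtain a b where "\<And>u. adjacent n pa u (pa e) \<Longrightarrow> max u (pa e) \<in> S \<Longrightarrow> max u (pa e) = e"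
      using large_enough_neighbours[OF tree large e, of "pa e"] by blast
    ultimately show False
      using \<open>pa e \<in> S\<close> by metis
  qed
qed


section \<open>Positions in lists\<close>

lemma last_before:
  fixes k :: nat
  assumes "l < k" "P l"
  obtains p where "l \<le> p" "p < k" "P p" "\<And>l'. p < l' \<Longrightarrow> l' < k \<Longrightarrow> \<not> P l'"
proof -
  have fin: "finite {p. p < k \<and> P p}"
    by (rule finite_subset[of _ "{..<k}"]) auto
  have mem: "l \<in> {p. p < k \<and> P p}"
    using assms by simp
  have "Max {p. p < k \<and> P p} \<in> {p. p < k \<and> P p}"
    using Max_in[OF fin] mem by blast
  moreover have "l' \<le> Max {p. p < k \<and> P p}" if "l' < k" "P l'" for l'
    using Max_ge[OF fin] that by simp
  ultimately show ?thesis
    using that[of "Max {p. p < k \<and> P p}"] assms leD by blast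
qed

lemma first_from:
  fixes k :: nat
  assumes "k < l" "P l"
  obtains q where "k < q" "q \<le> l" "P q" "\<And>l'. k < l' \<Longrightarrow> l' < q \<Longrightarrow> \<not> P l'"
proof -
  have ex: "k < l \<and> P l"
    using assms by simp
  show ?thesis
    using that[of "LEAST q. k < q \<and> P q"] LeastI[of "\<lambda>q. k < q \<and> P q", OF ex]
      Least_le[of "\<lambda>q. k < q \<and> P q", OF ex] not_less_Least[of _ "\<lambda>q. k < q \<and> P q"]
    by blast
qed

text \<open>Consecutive entries of the list of jump positions are exactly the neighbouring jumps.\<close>

lemma filter_upt_consecutive:
  assumes "k + 1 < length (filter P [0..<L])"
  defines "pos \<equiv> filter P [0..<L]"
  shows "pos ! k < pos ! (k + 1)" "pos ! (k + 1) < L" "P (pos ! k)" "P (pos ! (k + 1))"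
    and "\<And>l. pos ! k < l \<Longrightarrow> l < pos ! (k + 1) \<Longrightarrow> \<not> P l"
proof -
  have sorted: "sorted_wrt (<) pos"
    unfolding pos_def by (intro sorted_wrt_filter) simp
  have len: "k + 1 < length pos"
    using assms(1) by (simp add: pos_def)
  show "pos ! k < pos ! (k + 1)"
    using sorted_wrt_nth_less[OF sorted _ len] by simp
  have mem: "pos ! k \<in> set pos" "pos ! (k + 1) \<in> set pos"
    using len by (simp_all del: One_nat_def)
  have set_pos: "set pos = {l. l < L \<and> P l}"
    unfolding pos_def by auto
  show "pos ! (k + 1) < L" "P (pos ! k)" "P (pos ! (k + 1))"
    using mem unfolding set_pos by auto
  show "\<not> P l" if l: "pos ! k < l" "l < pos ! (k + 1)" for l
  proof
    assume "P l"
    then have "l \<in> set pos"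
      using l(2) \<open>pos ! (k + 1) < L\<close> unfolding set_pos by simp
    then obtain m where m: "m < length pos" "l = pos ! m"
      unfolding in_set_conv_nth by blast
    have "k < m"
    proof (rule ccontr)
      assume "\<not> k < m"
      then have "m < k \<or> m = k" by auto
      then have "pos ! m \<le> pos ! k"
        using sorted_wrt_nth_less[OF sorted, of m k] len by auto
      then show False using l m by simp
    qed
    moreover have "m < k + 1"
    proof (rule ccontr)
      assume "\<not> m < k + 1"
      then have "k + 1 < m \<or> m = k + 1" by auto
      then have "pos ! (k + 1) \<le> pos ! m"
        using sorted_wrt_nth_less[OF sorted, of "k + 1" m] m(1) by auto
      then show False using l m by simp
    qed
    ultimately show False by simp
  qed
qed

lemma filter_upt_consecutive_index:
  assumes "p < q" "q < L" "P p" "P q" "\<And>l. p < l \<Longrightarrow> l < q \<Longrightarrow> \<not> P l"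
  obtains k where "k + 1 < length (filter P [0..<L])"
    "filter P [0..<L] ! k = p" "filter P [0..<L] ! (k + 1) = q"
proof -
  define pos where "pos = filter P [0..<L]"
  have sorted: "sorted_wrt (<) pos"
    unfolding pos_def by (intro sorted_wrt_filter) simp
  have set_pos: "set pos = {l. l < L \<and> P l}"
    unfolding pos_def by auto
  have "p \<in> set pos" "q \<in> set pos"
    using assms unfolding set_pos by auto
  then obtain k m where k: "k < length pos" "pos ! k = p" and m: "m < length pos" "pos ! m = q"
    unfolding in_set_conv_nth by blast
  have "k < m"
  proof (rule ccontr)
    assume "\<not> k < m"
    then have "m < k \<or> m = k" by auto
    then have "pos ! m \<le> pos ! k"
      using sorted_wrt_nth_less[OF sorted, of m k] k(1) by auto
    then show False using k m assms(1) by simp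
  qed
  have "m = k + 1"
  proof (rule ccontr)
    assume "m \<noteq> k + 1"
    with \<open>k < m\<close> have m': "k + 1 < m" by simp
    have "p < pos ! (k + 1)" "pos ! (k + 1) < q"
      using sorted_wrt_nth_less[OF sorted, of k "k + 1"] sorted_wrt_nth_less[OF sorted m' m(1)]
        k m m' by simp_all
    moreover have "pos ! (k + 1) \<in> set pos"
      using m(1) m' by (simp del: One_nat_def)
    then have "P (pos ! (k + 1))"
      unfolding set_pos by simp
    ultimately show False using assms(5) by blast
  qed
  then show ?thesis
    using that[of k] k m unfolding pos_def by simp
qed

lemma last_filter_eq:
  assumes "p < length xs" "P (xs ! p)" "\<And>l. p < l \<Longrightarrow> l < length xs \<Longrightarrow> \<not> P (xs ! l)"
  shows "last (filter P xs) = xs ! p"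
proof -
  have "filter P (drop (Suc p) xs) = []"
    unfolding filter_empty_conv
  proof
    fix x assume "x \<in> set (drop (Suc p) xs)"
    then obtain i where "i < length (drop (Suc p) xs)" "drop (Suc p) xs ! i = x"
      unfolding in_set_conv_nth by blast
    then show "\<not> P x"
      using assms(3)[of "Suc p + i"] by simp
  qed
  then have "filter P xs = filter P (take p xs) @ [xs ! p]"
    using assms(2) by (subst id_take_nth_drop[OF assms(1)]) simp
  then show ?thesis by simp
qed

lemma hd_filter_eq:
  assumes "q < length xs" "P (xs ! q)" "\<And>l. l < q \<Longrightarrow> \<not> P (xs ! l)"
  shows "hd (filter P xs) = xs ! q"
proof -
  have "filter P (take q xs) = []"
    unfolding filter_empty_conv
  proof
    fix x assume "x \<in> set (take q xs)"
    then obtain i where "i < length (take q xs)" "take q xs ! i = x"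
      unfolding in_set_conv_nth by blast
    then show "\<not> P x"
      using assms(3)[of i] by simp
  qed
  then have "filter P xs = xs ! q # filter P (drop (Suc q) xs)"
    using assms(2) by (subst id_take_nth_drop[OF assms(1)]) simp
  then show ?thesis by simp
qed

lemma take_drop_while_nth:
  assumes "distinct xs" "p < length xs"
  shows "length (takeWhile (\<lambda>u. u \<noteq> xs ! p) xs) = p"
    and "length (dropWhile (\<lambda>u. u \<noteq> xs ! p) xs) = length xs - p"
proof -
  have "takeWhile (\<lambda>u. u \<noteq> xs ! p) xs = take p xs"
  proof (rule takeWhile_eq_take_P_nth)
    show "xs ! i \<noteq> xs ! p" if "i < p" "i < length xs" for i
      using that nth_eq_iff_index_eq[OF assms(1) that(2) assms(2)] by simp
  qed simp
  then show take: "length (takeWhile (\<lambda>u. u \<noteq> xs ! p) xs) = p"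
    using assms(2) by simp
  have "length (takeWhile (\<lambda>u. u \<noteq> xs ! p) xs) + length (dropWhile (\<lambda>u. u \<noteq> xs ! p) xs) = length xs"
    by (metis length_append takeWhile_dropWhile_id)
  then show "length (dropWhile (\<lambda>u. u \<noteq> xs ! p) xs) = length xs - p"
    using take by simp
qed

section \<open>Linear profiles with end values in the unit interval\<close>

lemma linear_interpolation_bound:
  fixes a b t :: real
  assumes "\<bar>a\<bar> \<le> 1" "\<bar>b\<bar> \<le> 1" "a \<noteq> b \<or> \<bar>a\<bar> < 1" "0 < t" "t < 1"
  shows "\<bar>(1 - t) * a + t * b\<bar> < 1"
proof -
  have upper: "(1 - t) * x + t * y < 1" if "x \<le> 1" "y \<le> 1" "x < 1 \<or> y < 1" for x y :: real
  proof -
    have "(1 - t) * x \<le> 1 - t" "t * y \<le> t"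
      using that assms(4,5) mult_left_mono[of x 1 "1 - t"] mult_left_mono[of y 1 t] by auto
    moreover have "(1 - t) * x < 1 - t \<or> t * y < t"
      using that(3) assms(4,5) mult_strict_left_mono[of x 1 "1 - t"] mult_strict_left_mono[of y 1 t]
      by auto
    ultimately show ?thesis by linarith
  qed
  have "(1 - t) * a + t * b < 1"
    using assms by (intro upper) auto
  moreover have "(1 - t) * (- a) + t * (- b) < 1"
    using assms by (intro upper) auto
  ultimately show ?thesis
    unfolding abs_less_iff by simp
qed

lemma segment_bound:
  fixes a b \<omega> :: real and k q :: nat
  assumes "\<bar>a\<bar> \<le> 1" "\<bar>b\<bar> \<le> 1" "a \<noteq> b \<or> \<bar>a\<bar> < 1" "0 < k" "k < q" "b = a - real q * \<omega>"
  shows "\<bar>a - real k * \<omega>\<bar> < 1"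
proof -
  define t where "t = real k / real q"
  have t: "0 < t" "t < 1"
    using assms(4,5) by (auto simp: t_def)
  have "t * real q = real k"
    using assms(4,5) by (simp add: t_def)
  then have "a - real k * \<omega> = (1 - t) * a + t * b"
    unfolding assms(6) by (simp add: algebra_simps flip: mult.assoc)
  then show ?thesis
    using linear_interpolation_bound[OF assms(1-3) t] by simp
qed

text \<open>
  Starting from a sign, the first step decides the direction and the last one the length: the
  values run from \<open>u\<close> towards \<open>- u\<close> and must not reach it.
\<close>

lemma ramp_from_sign_bound:
  fixes u \<omega> :: real and N :: nat
  assumes u: "\<bar>u\<bar> = 1" and N: "1 \<le> N"
  shows "(\<forall>k. 1 \<le> k \<and> k \<le> N \<longrightarrow> \<bar>u - real k * \<omega>\<bar> < 1) \<longleftrightarrow> 0 < u * \<omega> \<and> real N * \<bar>\<omega>\<bar> < 2"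
proof -
  have u': "u = 1 \<or> u = -1" using u by linarith
  have reduce: "\<bar>u - real k * \<omega>\<bar> < 1 \<longleftrightarrow> 0 < real k * (u * \<omega>) \<and> real k * (u * \<omega>) < 2" for k
    using u' by auto
  have abs: "\<bar>\<omega>\<bar> = u * \<omega>" if "0 < u * \<omega>"
    using u' that by auto
  show ?thesis
  proof
    assume L: "\<forall>k. 1 \<le> k \<and> k \<le> N \<longrightarrow> \<bar>u - real k * \<omega>\<bar> < 1"
    have "0 < u * \<omega>"
      using L[rule_format, of 1] N unfolding reduce by simp
    moreover have "real N * (u * \<omega>) < 2"
      using L[rule_format, of N] N unfolding reduce by simp
    ultimately show "0 < u * \<omega> \<and> real N * \<bar>\<omega>\<bar> < 2"
      using abs by simp
  next
    assume R: "0 < u * \<omega> \<and> real N * \<bar>\<omega>\<bar> < 2"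
    show "\<forall>k. 1 \<le> k \<and> k \<le> N \<longrightarrow> \<bar>u - real k * \<omega>\<bar> < 1"
    proof (intro allI impI)
      fix k assume k: "1 \<le> k \<and> k \<le> N"
      have "real k * (u * \<omega>) \<le> real N * (u * \<omega>)"
        using k R by (intro mult_right_mono) auto
      moreover have "0 < real k * (u * \<omega>)"
        using k R by simp
      ultimately show "\<bar>u - real k * \<omega>\<bar> < 1"
        unfolding reduce using R abs by auto
    qed
  qed
qed

text \<open>
  The arms of a star leave the signs \<open>z1\<close> and \<open>z c\<close> with slopes \<open>- \<omega>\<close> and \<open>\<omega>\<close>. Both sides of the
  equivalence make every \<open>z c\<close> equal to \<open>- z1\<close>. Under that assumption the balance equation gives
  \<open>\<bar>\<omega>\<bar> = (K + 1) / bstar\<close>, and the length bounds on the two sides are the same.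
\<close>

lemma star_component_feasible_iff:
  fixes ch :: "nat set" and z :: "nat \<Rightarrow> real" and b :: "nat \<Rightarrow> nat" and z1 \<omega> :: real and b1 :: nat
  assumes fin: "finite ch" and z1: "\<bar>z1\<bar> = 1" and z: "\<And>c. c \<in> ch \<Longrightarrow> \<bar>z c\<bar> = 1"
    and b1: "2 \<le> b1" and b: "\<And>c. c \<in> ch \<Longrightarrow> 1 \<le> b c"
    and balance: "z1 - (\<Sum>c\<in>ch. z c) = (real b1 + (\<Sum>c\<in>ch. real (b c))) * \<omega>"
  shows "(\<forall>k. 1 \<le> k \<and> k \<le> b1 - 1 \<longrightarrow> \<bar>z1 - real k * \<omega>\<bar> < 1) \<and>
      (\<forall>c\<in>ch. \<forall>k. 1 \<le> k \<and> k \<le> b c \<longrightarrow> \<bar>z c + real k * \<omega>\<bar> < 1)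
    \<longleftrightarrow> (\<forall>c\<in>ch. z1 * z c < 0) \<and> (\<forall>c\<in>ch. \<forall>c'\<in>ch. z c * z c' > 0) \<and>
      real b1 - 1 < 2 / (real (card ch) + 1) * (real b1 + (\<Sum>c\<in>ch. real (b c))) \<and>
      (\<forall>c\<in>ch. real (b c) < 2 / (real (card ch) + 1) * (real b1 + (\<Sum>c\<in>ch. real (b c))))"
    (is "?L1 \<and> ?L2 \<longleftrightarrow> ?R1 \<and> ?R2 \<and> ?R3 \<and> ?R4")
proof -
  define bstar where "bstar = real b1 + (\<Sum>c\<in>ch. real (b c))"
  define K where "K = real (card ch)"
  have bstar: "0 < bstar"
    unfolding bstar_def using b1 by (intro add_pos_nonneg sum_nonneg) auto
  have K: "0 \<le> K" by (simp add: K_def)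
  have L1: "?L1 \<longleftrightarrow> 0 < z1 * \<omega> \<and> (real b1 - 1) * \<bar>\<omega>\<bar> < 2"
    using ramp_from_sign_bound[OF z1, of "b1 - 1" \<omega>] b1 by (simp add: of_nat_diff)
  have L2: "?L2 \<longleftrightarrow> (\<forall>c\<in>ch. z c * \<omega> < 0 \<and> real (b c) * \<bar>\<omega>\<bar> < 2)"
    using ramp_from_sign_bound[OF z b, of _ _ "- \<omega>"] by simp
  have z1': "z1 = 1 \<or> z1 = -1" using z1 by linarith
  have z': "z c = 1 \<or> z c = -1" if "c \<in> ch" for c using z[OF that] by linarith
  have opposite: "bstar * \<omega> = (K + 1) * z1" "\<bar>\<omega>\<bar> = (K + 1) / bstar" if opp: "\<forall>c\<in>ch. z c = - z1"
  proof -
    have "(\<Sum>c\<in>ch. z c) = (\<Sum>c\<in>ch. - z1)"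
      using opp by (intro sum.cong) auto
    then show eq: "bstar * \<omega> = (K + 1) * z1"
      using balance by (simp add: bstar_def K_def algebra_simps)
    have "bstar * \<bar>\<omega>\<bar> = \<bar>bstar * \<omega>\<bar>"
      using bstar by (simp add: abs_mult)
    also have "\<dots> = K + 1"
      unfolding eq using z1 K by (simp add: abs_mult)
    finally show "\<bar>\<omega>\<bar> = (K + 1) / bstar"
      using bstar by (simp add: field_simps)
  qed
  have size: "x * ((K + 1) / bstar) < 2 \<longleftrightarrow> x < 2 / (K + 1) * bstar" for x
    using bstar K by (simp add: field_simps)
  have "?L1 \<and> ?L2 \<longleftrightarrow> (\<forall>c\<in>ch. z c = - z1) \<and> ?R3 \<and> ?R4"
  proof
    assume L: "?L1 \<and> ?L2"
    then have pos: "0 < z1 * \<omega>" and neg: "\<And>c. c \<in> ch \<Longrightarrow> z c * \<omega> < 0"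
      unfolding L1 L2 by auto
    have opp: "\<forall>c\<in>ch. z c = - z1"
    proof
      fix c assume c: "c \<in> ch"
      then show "z c = - z1"
        using pos neg[OF c] z1' z'[OF c] by auto
    qed
    show "(\<forall>c\<in>ch. z c = - z1) \<and> ?R3 \<and> ?R4"
      using L opp unfolding L1 L2 opposite(2)[OF opp] size
      unfolding K_def bstar_def by blast
  next
    assume R: "(\<forall>c\<in>ch. z c = - z1) \<and> ?R3 \<and> ?R4"
    then have opp: "\<forall>c\<in>ch. z c = - z1" by blast
    have "bstar * (z1 * \<omega>) = z1 * (bstar * \<omega>)" by simp
    also have "\<dots> = K + 1"
      unfolding opposite(1)[OF opp] using z1' by auto
    finally have "0 < bstar * (z1 * \<omega>)"
      using K by simp
    then have pos: "0 < z1 * \<omega>"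
      using bstar by (simp add: zero_less_mult_iff)
    then have neg: "z c * \<omega> < 0" if "c \<in> ch" for c
      using opp that by simp
    show "?L1 \<and> ?L2"
      using R pos neg unfolding L1 L2 opposite(2)[OF opp] size
      unfolding K_def bstar_def by blast
  qed
  also have "(\<forall>c\<in>ch. z c = - z1) \<longleftrightarrow> ?R1 \<and> ?R2"
  proof
    assume "\<forall>c\<in>ch. z c = - z1"
    then show "?R1 \<and> ?R2" using z1' by auto
  next
    assume R: "?R1 \<and> ?R2"
    show "\<forall>c\<in>ch. z c = - z1"
    proof
      fix c assume c: "c \<in> ch"
      then have "z1 * z c < 0" using R by blast
      then show "z c = - z1" using z1' z'[OF c] by auto
    qed
  qed
  finally show ?thesis by blast
qed


section \<open>Branch paths\<close>

lemma chain_to_root_side: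
  assumes tree: "rooted_tree n pa"
  shows "v \<in> {1..n} \<Longrightarrow> \<exists>ys. ys \<noteq> [] \<and> downward n pa ys \<and> last ys = v \<and> hd ys \<in> {1..n} \<and>
    (hd ys = 1 \<or> ramification_point n pa (pa (hd ys))) \<and>
    (\<forall>u\<in>set (butlast ys). \<not> ramification_point n pa u)"
proof (induction v rule: less_induct)
  case (less v)
  show ?case
  proof (cases "v = 1 \<or> ramification_point n pa (pa v)")
    case True
    then show ?thesis
      using less.prems by (intro exI[of _ "[v]"]) auto
  next
    case False
    then have v: "v \<in> {2..n}" using less.prems by auto
    then obtain ys where ys: "ys \<noteq> []" "downward n pa ys" "last ys = pa v" "hd ys \<in> {1..n}"
      "hd ys = 1 \<or> ramification_point n pa (pa (hd ys))"
      "\<forall>u\<in>set (butlast ys). \<not> ramification_point n pa u"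
      using less.IH parent_bounds[OF tree v] by blast
    have "set ys = insert (pa v) (set (butlast ys))"
      using append_butlast_last_id[OF ys(1)] ys(3) by (metis list.set(1,2) set_append Un_insert_right sup_bot_right)
    then show ?thesis
      using v ys False by (intro exI[of _ "ys @ [v]"]) (simp add: successively_append_iff children_def)
  qed
qed

lemma chain_to_leaf_side:
  assumes tree: "rooted_tree n pa"
  shows "v \<in> {1..n} \<Longrightarrow> \<exists>zs. zs \<noteq> [] \<and> downward n pa zs \<and> hd zs = v \<and>
    (\<forall>u\<in>set (butlast zs). \<not> ramification_point n pa u) \<and>
    (ramification_point n pa (last zs) \<or> children n pa (last zs) = {})"
proof (induction v rule: measure_induct_rule[of "\<lambda>v. n - v"])
  case (less v)
  show ?case
  proof (cases "ramification_point n pa v \<or> children n pa v = {}")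
    case True
    then show ?thesis
      by (intro exI[of _ "[v]"]) auto
  next
    case False
    then obtain c where c: "c \<in> children n pa v" by blast
    then have "c \<in> {2..n}" "pa c = v" by (simp_all add: children_def)
    moreover from this have "v < c"
      using parent_bounds(2)[OF tree, of c] by simp
    ultimately have "n - c < n - v" "c \<in> {1..n}" by auto
    then obtain zs where zs: "zs \<noteq> []" "downward n pa zs" "hd zs = c"
      "\<forall>u\<in>set (butlast zs). \<not> ramification_point n pa u"
      "ramification_point n pa (last zs) \<or> children n pa (last zs) = {}"
      using less.IH by blast
    then show ?thesis
      using c False by (intro exI[of _ "v # zs"]) (simp add: successively_Cons)
  qed
qed

lemma branch_path_through:
  assumes tree: "rooted_tree n pa" and v: "v \<in> {1..n}"
  obtains xs where "branch_path n pa xs" "v \<in> set xs"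
proof -
  obtain ys where ys: "ys \<noteq> []" "downward n pa ys" "last ys = v" "hd ys \<in> {1..n}"
    "hd ys = 1 \<or> ramification_point n pa (pa (hd ys))"
    "\<forall>u\<in>set (butlast ys). \<not> ramification_point n pa u"
    using chain_to_root_side[OF tree v] by blast
  obtain zs where zs: "zs \<noteq> []" "downward n pa zs" "hd zs = v"
    "\<forall>u\<in>set (butlast zs). \<not> ramification_point n pa u"
    "ramification_point n pa (last zs) \<or> children n pa (last zs) = {}"
    using chain_to_leaf_side[OF tree v] by blast
  define xs where "xs = butlast ys @ zs"
  have split: "ys = butlast ys @ [v]"
    using append_butlast_last_id[OF ys(1)] ys(3) by simp
  have hd: "hd xs = hd ys"
  proof (cases "butlast ys = []")
    case True
    then have "ys = [v]" using split by simp
    then show ?thesis using zs(3) by (simp add: xs_def)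
  next
    case False
    then show ?thesis
      unfolding xs_def by (subst (2) split) (simp only: hd_append if_False)
  qed
  have down: "downward n pa xs"
  proof -
    have "downward n pa (butlast ys @ [v])"
      using ys(2) split by metis
    then show ?thesis
      using zs(1-3) unfolding xs_def successively_append_iff by simp
  qed
  have "xs \<noteq> []" "last xs = last zs" "butlast xs = butlast ys @ butlast zs"
    using zs(1) by (simp_all add: xs_def butlast_append)
  then have "branch_path n pa xs"
    unfolding branch_path_def
    using downward_vertex_path[OF tree down] down hd ys(4-6) zs(4,5) by auto
  moreover have "v \<in> set xs"
    using hd_in_set[OF zs(1)] zs(3) by (simp add: xs_def)
  ultimately show ?thesis by (rule that)
qed

lemma branch_path_nth:
  assumes "branch_path n pa xs"
  shows "xs \<noteq> []" "distinct xs" "set xs \<subseteq> {1..n}"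
    and "\<And>k. Suc k < length xs \<Longrightarrow> xs ! Suc k \<in> children n pa (xs ! k)"
    and "\<And>k. Suc k < length xs \<Longrightarrow> \<not> ramification_point n pa (xs ! k)"
proof -
  have path: "vertex_path n pa xs" and down: "downward n pa xs"
    and inner: "\<forall>v\<in>set (butlast xs). \<not> ramification_point n pa v"
    using assms unfolding branch_path_def by blast+
  show "xs \<noteq> []" "distinct xs" "set xs \<subseteq> {1..n}"
    using path unfolding vertex_path_def by blast+
  show "xs ! Suc k \<in> children n pa (xs ! k)" if "Suc k < length xs" for k
    using down that unfolding successively_conv_nth by blast
  show "\<not> ramification_point n pa (xs ! k)" if k: "Suc k < length xs" for k
  proof -
    have "k < length (butlast xs)" using k by simp
    then have "butlast xs ! k \<in> set (butlast xs)" "butlast xs ! k = xs ! k"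
      by (rule nth_mem, rule nth_butlast)
    then show ?thesis using inner by simp
  qed
qed

lemma branch_path_from_child:
  assumes tree: "rooted_tree n pa" and "ramification_point n pa v" "c \<in> children n pa v"
  obtains xs where "branch_path n pa xs" "hd xs = c"
proof -
  have c: "c \<in> {1..n}" "pa c = v"
    using assms(3) by (simp_all add: children_def)
  obtain xs where xs: "branch_path n pa xs" "c \<in> set xs"
    using branch_path_through[OF tree c(1)] by blast
  note nth = branch_path_nth[OF xs(1)]
  obtain k where k: "k < length xs" "xs ! k = c"
    using xs(2) unfolding in_set_conv_nth by blast
  have "k = 0"
  proof (cases k)
    case (Suc k')
    then have "c \<in> children n pa (xs ! k')" "\<not> ramification_point n pa (xs ! k')"
      using nth(4,5)[of k'] k by simp_all
    then show ?thesis
      using c(2) assms(2) by (simp add: children_def)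
  qed
  then have "hd xs = c"
    using k(2) hd_conv_nth[OF nth(1)] by metis
  then show ?thesis using xs(1) that by blast
qed

lemma branch_path_to_ramification:
  assumes tree: "rooted_tree n pa" and v: "ramification_point n pa v"
  obtains xs where "branch_path n pa xs" "last xs = v"
proof -
  have "v \<in> {1..n}" using v by (simp add: ramification_point_def)
  then obtain xs where xs: "branch_path n pa xs" "v \<in> set xs"
    using branch_path_through[OF tree] by blast
  have "v \<notin> set (butlast xs)"
    using xs(1) v unfolding branch_path_def by blast
  moreover have "xs = butlast xs @ [last xs]"
    using branch_path_nth(1)[OF xs(1)] by simp
  ultimately have "last xs = v"
    using xs(2) by (metis Un_iff empty_iff insert_iff list.set(1) list.set(2) set_append)
  then show ?thesis using xs(1) that by blast
qed

section \<open>Subtree sums along branch paths\<close>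

text \<open>
  The setting after the linear algebra: \<open>w\<close> is known only through its constancy across edges without a
  jump and through its prescribed subtree sums. The decomposition into long paths enters as the isolation of
  jumps from each other and from ramification points.
\<close>

locale jump_profile =
  fixes n :: nat and pa :: "nat \<Rightarrow> nat" and f0 w :: "nat \<Rightarrow> real"
  assumes tree: "rooted_tree n pa"
    and root_degree: "vertex_degree n pa 1 \<le> 1"
    and jumps_around: "jumps_around_ramifications n pa (true_jumps n pa f0)"
    and isolated: "\<And>e. e \<in> true_jumps n pa f0 \<Longrightarrow> \<not> ramification_point n pa e \<and>
      \<not> ramification_point n pa (pa e) \<and> pa e \<notin> true_jumps n pa f0"
    and w_const: "\<And>i. i \<in> {2..n} - true_jumps n pa f0 \<Longrightarrow> w i = w (pa i)"
    and W_root: "subtree_sum n pa w 1 = 0"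
    and W_jump: "\<And>j. j \<in> true_jumps n pa f0 \<Longrightarrow> subtree_sum n pa w j = jump_sgn pa f0 j"
begin

abbreviation "S \<equiv> true_jumps n pa f0"
abbreviation "W \<equiv> subtree_sum n pa w"
abbreviation "z \<equiv> jump_sgn pa f0"

lemma abs_sign: "j \<in> S \<Longrightarrow> \<bar>z j\<bar> = 1"
  by (simp add: true_jumps_def jump_sgn_def abs_sgn_eq)

lemma nonramification_children:
  assumes "v \<in> {1..n}" "\<not> ramification_point n pa v" "c \<in> children n pa v"
  shows "children n pa v = {c}"
proof -
  have deg: "vertex_degree n pa v \<le> 2"
    using assms(1,2) by (auto simp: ramification_point_def)
  have "card (children n pa v) \<le> 1"
  proof (cases "v = 1")
    case True
    then show ?thesis using root_degree vertex_degree_root[OF tree] by simp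
  next
    case False
    then have "v \<in> {2..n}" using assms(1) by auto
    then show ?thesis using deg vertex_degree_nonroot[OF tree] by simp
  qed
  moreover have "{c} \<subseteq> children n pa v" using assms(3) by blast
  ultimately show ?thesis
    using card_seteq[OF finite_children, of "{c}" n pa v] by simp
qed

lemma W_branch_step:
  assumes xs: "branch_path n pa xs" and k: "Suc k < length xs"
  shows "W (xs ! k) = w (xs ! k) + W (xs ! Suc k)"
proof -
  note nth = branch_path_nth[OF xs]
  have v: "xs ! k \<in> {1..n}"
    using nth(3) nth_mem[OF Suc_lessD[OF k]] by blast
  show ?thesis
    using subtree_sum_children[OF tree v] nonramification_children[OF v nth(5)[OF k] nth(4)[OF k]]
    by simp
qed

lemma w_branch_const:
  assumes xs: "branch_path n pa xs" and "p \<le> k" "k < length xs"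
    and none: "\<And>l. p < l \<Longrightarrow> l \<le> k \<Longrightarrow> xs ! l \<notin> S"
  shows "w (xs ! k) = w (xs ! p)"
  using assms(2-)
proof (induction k rule: dec_induct)
  case (step k)
  have "xs ! Suc k \<in> children n pa (xs ! k)"
    using branch_path_nth(4)[OF xs] step.prems(1) by blast
  then have "w (xs ! Suc k) = w (xs ! k)"
    using w_const[of "xs ! Suc k"] step.prems(2)[of "Suc k"] step.hyps by (simp add: children_def)
  also have "\<dots> = w (xs ! p)"
    using step.prems by (intro step.IH) auto
  finally show ?case .
qed simp

lemma W_branch_linear:
  assumes xs: "branch_path n pa xs" and "p \<le> k" "k < length xs"
    and none: "\<And>l. p < l \<Longrightarrow> l < k \<Longrightarrow> xs ! l \<notin> S"
  shows "W (xs ! k) = W (xs ! p) - real (k - p) * w (xs ! p)"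
  using assms(2-)
proof (induction k rule: dec_induct)
  case (step k)
  have "W (xs ! k) = W (xs ! p) - real (k - p) * w (xs ! p)"
    using step.prems by (intro step.IH) auto
  moreover have "w (xs ! k) = w (xs ! p)"
    using step by (intro w_branch_const[OF xs]) auto
  moreover have "W (xs ! k) = w (xs ! k) + W (xs ! Suc k)"
    by (rule W_branch_step[OF xs step.prems(1)])
  moreover have "real (Suc k - p) = real (k - p) + 1"
    using step.hyps by (simp add: of_nat_diff)
  ultimately show ?case
    by (simp add: algebra_simps)
qed simp

text \<open>At a leaf \<open>W\<close> equals \<open>w\<close>, so the linear profile would reach \<open>0\<close> one step further on.\<close>

lemma W_branch_leaf:
  assumes xs: "branch_path n pa xs" and "p < length xs" "children n pa (last xs) = {}"
    and none: "\<And>l. p < l \<Longrightarrow> l < length xs \<Longrightarrow> xs ! l \<notin> S"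
  shows "0 = W (xs ! p) - real (length xs - p) * w (xs ! p)"
proof -
  define k where "k = length xs - 1"
  have k: "p \<le> k" "k < length xs" "length xs = Suc k"
    using assms(2) by (auto simp: k_def)
  have "last xs = xs ! k"
    unfolding k_def by (rule last_conv_nth[OF branch_path_nth(1)[OF xs]])
  moreover have "xs ! k \<in> {1..n}"
    using branch_path_nth(3)[OF xs] nth_mem[OF k(2)] by blast
  ultimately have "W (xs ! k) = w (xs ! k)"
    using subtree_sum_children[OF tree, of "xs ! k" w] assms(3) by simp
  moreover have "W (xs ! k) = W (xs ! p) - real (k - p) * w (xs ! p)"
    using k none by (intro W_branch_linear[OF xs]) auto
  moreover have "w (xs ! k) = w (xs ! p)"
    using k none by (intro w_branch_const[OF xs]) auto
  moreover have "real (length xs - p) = real (k - p) + 1"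
    using k by (simp add: of_nat_diff)
  ultimately show ?thesis
    by (simp add: algebra_simps)
qed

lemma adjacent_not_both_jumps:
  assumes xs: "branch_path n pa xs" and "Suc k < length xs" "xs ! Suc k \<in> S"
  shows "xs ! k \<notin> S"
  using isolated[OF assms(3)] branch_path_nth(4)[OF xs assms(2)] by (simp add: children_def)

section \<open>Conditions (A) and (B)\<close>

text \<open>
  Adjacent positions cannot both be jumps, so the alternative of consecutive jumps leaves at most one
  jump on the path, and then the signs alternate vacuously.
\<close>

lemma condition_A_iff:
  "condition_A n pa f0 \<longleftrightarrow>
    (\<forall>xs p q. branch_path n pa xs \<longrightarrow> p < q \<longrightarrow> q < length xs \<longrightarrow> xs ! p \<in> S \<longrightarrow> xs ! q \<in> S \<longrightarrow>
      (\<forall>l. p < l \<longrightarrow> l < q \<longrightarrow> xs ! l \<notin> S) \<longrightarrow> z (xs ! p) * z (xs ! q) < 0)"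
    (is "_ \<longleftrightarrow> ?alternating")
proof
  assume A: "condition_A n pa f0"
  show ?alternating
  proof (intro allI impI)
    fix xs p q
    assume xs: "branch_path n pa xs" and pq: "p < q" "q < length xs" "xs ! p \<in> S" "xs ! q \<in> S"
      and none: "\<forall>l. p < l \<longrightarrow> l < q \<longrightarrow> xs ! l \<notin> S"
    define pos where "pos = filter (\<lambda>k. xs ! k \<in> S) [0..<length xs]"
    obtain k where k: "k + 1 < length pos" "pos ! k = p" "pos ! (k + 1) = q"
      unfolding pos_def using filter_upt_consecutive_index[of p q "length xs" "\<lambda>k. xs ! k \<in> S"] pq none
      by blast
    have "q \<noteq> p + 1"
      using adjacent_not_both_jumps[OF xs, of p] pq by auto
    then have "pos ! (k + 1) - pos ! (k + 1 - 1) \<noteq> 1"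
      using k pq(1) by simp
    moreover have "length pos \<noteq> 1" "1 \<le> k + 1"
      using k(1) by auto
    ultimately have "\<not> (length pos = 1 \<or> (\<forall>k. 1 \<le> k \<and> k < length pos \<longrightarrow> pos ! k - pos ! (k - 1) = 1))"
      using k(1) by blast
    then have "\<forall>k. k + 1 < length pos \<longrightarrow> z (xs ! (pos ! k)) * z (xs ! (pos ! (k + 1))) < 0"
      using A xs unfolding condition_A_def Let_def pos_def by blast
    then show "z (xs ! p) * z (xs ! q) < 0"
      using k by metis
  qed
next
  assume alt: ?alternating
  show "condition_A n pa f0"
    unfolding condition_A_def Let_def
  proof (intro allI impI disjI2)
    fix xs k
    assume xs: "branch_path n pa xs"
      and k: "k + 1 < length (filter (\<lambda>k. xs ! k \<in> S) [0..<length xs])"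
    show "z (xs ! (filter (\<lambda>k. xs ! k \<in> S) [0..<length xs] ! k)) *
        z (xs ! (filter (\<lambda>k. xs ! k \<in> S) [0..<length xs] ! (k + 1))) < 0"
      using alt xs filter_upt_consecutive[OF k] by blast
  qed
qed

text \<open>
  The position \<open>p\<close> is that of \<open>j1\<close>. From there to the ramification point \<open>w\<close> has the value \<open>w v\<close>,
  which makes the slope of \<open>W\<close> the same on all arms of the star around \<open>v\<close>.
\<close>

lemma ramification_main_branch:
  assumes v: "ramification_point n pa v" and m: "branch_path n pa m" "last m = v"
  obtains p where "p < length m" "m ! p \<in> S" "\<And>l. p < l \<Longrightarrow> l < length m \<Longrightarrow> m ! l \<notin> S"
    "last (filter (\<lambda>u. u \<in> S) m) = m ! p" "length (dropWhile (\<lambda>u. u \<noteq> m ! p) m) = length m - p"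
    "2 \<le> length m - p"
    "\<And>l. p \<le> l \<Longrightarrow> l < length m \<Longrightarrow> W (m ! l) = z (m ! p) - real (l - p) * w v"
proof -
  note nth = branch_path_nth[OF m(1)]
  have "set m \<inter> S \<noteq> {}"
    using jumps_around m v unfolding jumps_around_ramifications_def by blast
  then obtain l where l: "l < length m" "m ! l \<in> S"
    by (metis Int_iff ex_in_conv in_set_conv_nth)
  obtain p where p: "p < length m" "m ! p \<in> S" "\<And>l. p < l \<Longrightarrow> l < length m \<Longrightarrow> m ! l \<notin> S"
    using last_before[of l "length m" "\<lambda>l. m ! l \<in> S"] l by blast
  have last: "v = m ! (length m - 1)"
    using m(2) last_conv_nth[OF nth(1)] by simp
  have "v \<notin> S"
    using isolated v by blast
  then have "p \<noteq> length m - 1"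
    using p(2) last by metis
  then have p2: "2 \<le> length m - p"
    using p(1) by linarith
  have "w (m ! (length m - 1)) = w (m ! p)"
    using p by (intro w_branch_const[OF m(1)]) auto
  then have w: "w (m ! p) = w v"
    using last by simp
  have "W (m ! l) = z (m ! p) - real (l - p) * w v" if "p \<le> l" "l < length m" for l
    using W_branch_linear[OF m(1) that] p(3) that W_jump[OF p(2)] w by simp
  moreover have "last (filter (\<lambda>u. u \<in> S) m) = m ! p"
    using p by (intro last_filter_eq) auto
  ultimately show ?thesis
    using that p take_drop_while_nth(2)[OF nth(2) p(1)] p2 by blast
qed

text \<open>
  The profile on a side arm is written from its far end, the first jump of the branch at position
  \<open>q\<close>, because that is where the value of \<open>W\<close> is known.
\<close>

lemma ramification_branch:
  assumes v: "ramification_point n pa v" and c: "c \<in> children n pa v"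
    and xs: "branch_path n pa xs" "hd xs = c"
  obtains q where "q < length xs" "xs ! q \<in> S" "\<forall>l<q. xs ! l \<notin> S"
    "hd (filter (\<lambda>u. u \<in> S) xs) = xs ! q" "length (takeWhile (\<lambda>u. u \<noteq> xs ! q) xs) = q"
    "1 \<le> q"
    "\<forall>l\<le>q. W (xs ! l) = z (xs ! q) + real (q - l) * w v"
proof -
  note nth = branch_path_nth[OF xs(1)]
  have c': "c \<in> {2..n}" "pa c = v"
    using c by (simp_all add: children_def)
  have "set xs \<inter> S \<noteq> {}"
    using jumps_around xs c'(1) unfolding jumps_around_ramifications_def by force
  then have ex: "\<exists>l. l < length xs \<and> xs ! l \<in> S"
    by (metis Int_iff ex_in_conv in_set_conv_nth)
  define q where "q = (LEAST l. l < length xs \<and> xs ! l \<in> S)"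
  have q: "q < length xs" "xs ! q \<in> S"
    using LeastI_ex[OF ex] unfolding q_def by blast+
  have none: "xs ! l \<notin> S" if "l < q" for l
    using not_less_Least[of l "\<lambda>l. l < length xs \<and> xs ! l \<in> S"] that q(1) unfolding q_def by auto
  have first: "c = xs ! 0"
    using xs(2) hd_conv_nth[OF nth(1)] by simp
  have "c \<notin> S"
    using isolated c'(2) v by blast
  then have "q \<noteq> 0"
    using q(2) first by metis
  then have q1: "1 \<le> q" by simp
  have w: "w (xs ! 0) = w v"
    using w_const[of c] c' \<open>c \<notin> S\<close> first by simp
  have lin: "W (xs ! l) = W (xs ! 0) - real l * w v" if "l \<le> q" for l
    using W_branch_linear[OF xs(1), of 0 l] that q(1) none w by simp
  have "W (xs ! l) = z (xs ! q) + real (q - l) * w v" if l: "l \<le> q" for l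
    using lin[OF l] lin[of q] W_jump[OF q(2)] l by (simp add: of_nat_diff algebra_simps)
  moreover have "hd (filter (\<lambda>u. u \<in> S) xs) = xs ! q"
    using q none by (intro hd_filter_eq) auto
  ultimately show ?thesis
    using that q none take_drop_while_nth(1)[OF nth(2) q(1)] q1 by blast
qed

text \<open>
  The vertices of the star other than \<open>j1\<close> are the positions after \<open>length m - b1\<close> on the main branch and
  the positions before \<open>b c\<close> on the branches. Expressing \<open>W v\<close> once along the main branch and once as
  a sum over the children of \<open>v\<close> gives the balance equation of the star, so that the condition at
  \<open>v\<close> bounds \<open>W\<close> at exactly these vertices.
\<close>

lemma condition_B_at_ramification:
  assumes v: "ramification_point n pa v" and m: "branch_path n pa m" "last m = v"
    and br: "\<forall>c\<in>children n pa v. branch_path n pa (br c) \<and> hd (br c) = c"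
  defines "ch \<equiv> children n pa v"
  defines "j1 \<equiv> last (filter (\<lambda>u. u \<in> S) m)" and "j \<equiv> \<lambda>c. hd (filter (\<lambda>u. u \<in> S) (br c))"
  defines "b1 \<equiv> length (dropWhile (\<lambda>u. u \<noteq> j1) m)"
    and "b \<equiv> \<lambda>c. length (takeWhile (\<lambda>u. u \<noteq> j c) (br c))"
  shows "(b1 \<noteq> 1 \<longrightarrow> (\<forall>c\<in>ch. b c \<noteq> 0 \<longrightarrow> z j1 * z (j c) < 0)) \<and>
      (\<forall>c\<in>ch. \<forall>c'\<in>ch. b c \<noteq> 0 \<and> b c' \<noteq> 0 \<longrightarrow> z (j c) * z (j c') > 0) \<and>
      real b1 - 1 < 2 / (real (card ch) + 1) * real (b1 + (\<Sum>c\<in>ch. b c)) \<and>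
      (\<forall>c\<in>ch. real (b c) < 2 / (real (card ch) + 1) * real (b1 + (\<Sum>c\<in>ch. b c)))
    \<longleftrightarrow> (\<forall>l. length m - b1 < l \<and> l < length m \<longrightarrow> \<bar>W (m ! l)\<bar> < 1) \<and>
      (\<forall>c\<in>ch. \<forall>l<b c. \<bar>W (br c ! l)\<bar> < 1)"
    and "\<forall>l. length m - b1 < l \<and> l < length m \<longrightarrow> m ! l \<in> {2..n} - S"
    and "\<forall>c\<in>ch. \<forall>l<b c. br c ! l \<in> {2..n} - S"
    and "length m - b1 < length m" "m ! (length m - b1) = j1" "j1 \<in> S"
    and "\<And>c. c \<in> ch \<Longrightarrow> b c < length (br c) \<and> br c ! b c = j c \<and> j c \<in> S"
proof -
  obtain p where p: "p < length m" "m ! p \<in> S" "\<And>l. p < l \<Longrightarrow> l < length m \<Longrightarrow> m ! l \<notin> S"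
    "j1 = m ! p" "length (dropWhile (\<lambda>u. u \<noteq> m ! p) m) = length m - p" "2 \<le> length m - p"
    "\<And>l. p \<le> l \<Longrightarrow> l < length m \<Longrightarrow> W (m ! l) = z (m ! p) - real (l - p) * w v"
    unfolding j1_def using ramification_main_branch[OF v m] by metis
  have b1: "b1 = length m - p" "p = length m - b1" "2 \<le> b1"
    using p(1,5,6) unfolding b1_def p(4) by simp_all
  have branch: "b c < length (br c) \<and> br c ! b c = j c \<and> j c \<in> S \<and> (\<forall>l<b c. br c ! l \<notin> S) \<and>
      1 \<le> b c \<and> (\<forall>l\<le>b c. W (br c ! l) = z (j c) + real (b c - l) * w v)" if c: "c \<in> ch" for c
  proof -
    have c': "c \<in> children n pa v" using c unfolding ch_def .
    obtain q where q: "q < length (br c)" "br c ! q \<in> S" "\<forall>l<q. br c ! l \<notin> S"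
      "hd (filter (\<lambda>u. u \<in> S) (br c)) = br c ! q" "length (takeWhile (\<lambda>u. u \<noteq> br c ! q) (br c)) = q"
      "1 \<le> q" "\<forall>l\<le>q. W (br c ! l) = z (br c ! q) + real (q - l) * w v"
      by (rule ramification_branch[OF v c' conjunct1[OF bspec[OF br c']] conjunct2[OF bspec[OF br c']]])
        (rule that; assumption)
    have j: "j c = br c ! q"
      unfolding j_def by (rule q(4))
    have "b c = q"
      using q(5) unfolding b_def j .
    then show ?thesis
      unfolding j using q(1,2,3,6,7) by blast
  qed
  have v2: "v \<in> {1..n}"
    using v by (simp add: ramification_point_def)
  have "W v = z j1 - real (length m - 1 - p) * w v"
    using p(7)[of "length m - 1"] p(1,4) m(2) last_conv_nth[OF branch_path_nth(1)[OF m(1)]] by simp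
  moreover have "W v = w v + (\<Sum>c\<in>ch. z (j c) + real (b c) * w v)"
  proof -
    have "W c = z (j c) + real (b c) * w v" if c: "c \<in> ch" for c
    proof -
      have "br c ! 0 = c"
        using br c hd_conv_nth[OF branch_path_nth(1)] unfolding ch_def by metis
      then show ?thesis using branch[OF c] by (metis diff_zero le0)
    qed
    then show ?thesis
      using subtree_sum_children[OF tree v2, of w] unfolding ch_def by simp
  qed
  moreover have "real (length m - 1 - p) = real b1 - 1"
    using b1 p(1) by linarith
  moreover have "(\<Sum>c\<in>ch. z (j c) + real (b c) * w v)
      = (\<Sum>c\<in>ch. z (j c)) + (\<Sum>c\<in>ch. real (b c)) * w v"
    unfolding sum.distrib sum_distrib_right ..
  ultimately have "z j1 - (real b1 - 1) * w v
      = w v + ((\<Sum>c\<in>ch. z (j c)) + (\<Sum>c\<in>ch. real (b c)) * w v)"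
    by metis
  then have balance: "z j1 - (\<Sum>c\<in>ch. z (j c)) = (real b1 + (\<Sum>c\<in>ch. real (b c))) * w v"
    unfolding distrib_right left_diff_distrib by linarith
  have main: "(\<forall>l. length m - b1 < l \<and> l < length m \<longrightarrow> \<bar>W (m ! l)\<bar> < 1)
      \<longleftrightarrow> (\<forall>k. 1 \<le> k \<and> k \<le> b1 - 1 \<longrightarrow> \<bar>z j1 - real k * w v\<bar> < 1)" (is "?X \<longleftrightarrow> ?Y")
  proof
    assume X: ?X
    show ?Y
    proof (intro allI impI)
      fix k assume "1 \<le> k \<and> k \<le> b1 - 1"
      then have k: "p < p + k" "p + k < length m"
        using b1(1) p(6) by linarith+
      then have "\<bar>W (m ! (p + k))\<bar> < 1"
        using X unfolding b1(2)[symmetric] by blast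
      then show "\<bar>z j1 - real k * w v\<bar> < 1"
        using p(7)[of "p + k"] k p(4) by simp
    qed
  next
    assume Y: ?Y
    show ?X
      unfolding b1(2)[symmetric]
    proof (intro allI impI)
      fix l assume l: "p < l \<and> l < length m"
      then have "1 \<le> l - p \<and> l - p \<le> b1 - 1"
        using b1(1) by linarith
      then have "\<bar>z j1 - real (l - p) * w v\<bar> < 1"
        using Y by blast
      then show "\<bar>W (m ! l)\<bar> < 1"
        using p(7)[of l] l p(4) by simp
    qed
  qed
  have side: "(\<forall>c\<in>ch. \<forall>l<b c. \<bar>W (br c ! l)\<bar> < 1)
      \<longleftrightarrow> (\<forall>c\<in>ch. \<forall>k. 1 \<le> k \<and> k \<le> b c \<longrightarrow> \<bar>z (j c) + real k * w v\<bar> < 1)" (is "?X \<longleftrightarrow> ?Y")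
  proof
    assume X: ?X
    show ?Y
    proof (intro ballI allI impI)
      fix c k assume c: "c \<in> ch" and k: "1 \<le> k \<and> k \<le> b c"
      then have "\<bar>W (br c ! (b c - k))\<bar> < 1"
        using X by simp
      moreover have "W (br c ! (b c - k)) = z (j c) + real (b c - (b c - k)) * w v"
        using branch[OF c] diff_le_self by blast
      moreover have "b c - (b c - k) = k"
        using k by simp
      ultimately show "\<bar>z (j c) + real k * w v\<bar> < 1"
        by metis
    qed
  next
    assume Y: ?Y
    show ?X
    proof (intro ballI allI impI)
      fix c l assume c: "c \<in> ch" and l: "l < b c"
      then have "1 \<le> b c - l \<and> b c - l \<le> b c"
        by linarith
      then have "\<bar>z (j c) + real (b c - l) * w v\<bar> < 1"
        using Y c by blast
      moreover have "W (br c ! l) = z (j c) + real (b c - l) * w v"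
        using branch[OF c] less_imp_le[OF l] by blast
      ultimately show "\<bar>W (br c ! l)\<bar> < 1"
        by argo
    qed
  qed
  have sum_real: "real (b1 + (\<Sum>c\<in>ch. b c)) = real b1 + (\<Sum>c\<in>ch. real (b c))"
    by simp
  have "b1 \<noteq> 1" "\<And>c. c \<in> ch \<Longrightarrow> b c \<noteq> 0"
    using b1(3) branch by force+
  moreover have "finite ch" by (simp add: ch_def)
  ultimately show "(b1 \<noteq> 1 \<longrightarrow> (\<forall>c\<in>ch. b c \<noteq> 0 \<longrightarrow> z j1 * z (j c) < 0)) \<and>
      (\<forall>c\<in>ch. \<forall>c'\<in>ch. b c \<noteq> 0 \<and> b c' \<noteq> 0 \<longrightarrow> z (j c) * z (j c') > 0) \<and>
      real b1 - 1 < 2 / (real (card ch) + 1) * real (b1 + (\<Sum>c\<in>ch. b c)) \<and>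
      (\<forall>c\<in>ch. real (b c) < 2 / (real (card ch) + 1) * real (b1 + (\<Sum>c\<in>ch. b c)))
    \<longleftrightarrow> (\<forall>l. length m - b1 < l \<and> l < length m \<longrightarrow> \<bar>W (m ! l)\<bar> < 1) \<and>
      (\<forall>c\<in>ch. \<forall>l<b c. \<bar>W (br c ! l)\<bar> < 1)"
    unfolding main side sum_real
    using star_component_feasible_iff[of ch "z j1" "\<lambda>c. z (j c)" b1 b "w v"] b1(3) balance
      abs_sign p(2,4) branch by simp
  show "\<forall>l. length m - b1 < l \<and> l < length m \<longrightarrow> m ! l \<in> {2..n} - S"
    unfolding b1(2)[symmetric]
  proof (intro allI impI)
    fix l assume l: "p < l \<and> l < length m"
    then have "m ! Suc (l - 1) \<in> children n pa (m ! (l - 1))"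
      by (intro branch_path_nth(4)[OF m(1)]) simp
    then show "m ! l \<in> {2..n} - S"
      using l p(3) by (simp add: children_def)
  qed
  show "\<forall>c\<in>ch. \<forall>l<b c. br c ! l \<in> {2..n} - S"
  proof (intro ballI allI impI)
    fix c l assume c: "c \<in> ch" and l: "l < b c"
    have xs: "branch_path n pa (br c)" "hd (br c) = c" "c \<in> {2..n}"
      using br c unfolding ch_def children_def by blast+
    have "br c ! l \<in> {2..n}"
    proof (cases l)
      case 0
      then show ?thesis
        using xs hd_conv_nth[OF branch_path_nth(1)[OF xs(1)]] by metis
    next
      case (Suc l')
      then have "br c ! Suc l' \<in> children n pa (br c ! l')"
        using l branch[OF c] by (intro branch_path_nth(4)[OF xs(1)]) simp
      then show ?thesis using Suc by (simp add: children_def)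
    qed
    then show "br c ! l \<in> {2..n} - S"
      using branch[OF c] l by blast
  qed
  show "length m - b1 < length m" "m ! (length m - b1) = j1" "j1 \<in> S"
    using p(1,2,4) unfolding b1(2)[symmetric] by simp_all
  show "\<And>c. c \<in> ch \<Longrightarrow> b c < length (br c) \<and> br c ! b c = j c \<and> j c \<in> S"
    using branch by blast
qed

lemma feasible_imp_condition_A:
  assumes feasible: "\<forall>i\<in>{2..n} - S. \<bar>W i\<bar> < 1"
  shows "condition_A n pa f0"
  unfolding condition_A_iff
proof (intro allI impI)
  fix xs p q
  assume xs: "branch_path n pa xs" and pq: "p < q" "q < length xs" "xs ! p \<in> S" "xs ! q \<in> S"
    and none: "\<forall>l. p < l \<longrightarrow> l < q \<longrightarrow> xs ! l \<notin> S"
  have "q \<noteq> Suc p"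
    using adjacent_not_both_jumps[OF xs, of p] pq by auto
  then have between: "p < Suc p" "Suc p < q" using pq(1) by auto
  have "xs ! Suc p \<in> children n pa (xs ! p)"
    using branch_path_nth(4)[OF xs] between pq(2) by simp
  then have "xs ! Suc p \<in> {2..n} - S"
    using none between by (simp add: children_def)
  then have less: "\<bar>W (xs ! Suc p)\<bar> < 1"
    using feasible by blast
  have next_W: "W (xs ! Suc p) = z (xs ! p) - w (xs ! p)"
    using W_branch_linear[OF xs, of p "Suc p"] W_jump[OF pq(3)] between pq(2) by simp
  have end_W: "z (xs ! q) = z (xs ! p) - real (q - p) * w (xs ! p)"
    using W_branch_linear[OF xs, of p q] W_jump[OF pq(3)] W_jump[OF pq(4)] pq none by simp
  have "z (xs ! q) \<noteq> z (xs ! p)"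
  proof
    assume "z (xs ! q) = z (xs ! p)"
    then have "w (xs ! p) = 0"
      using end_W pq(1) by simp
    then show False
      using less next_W abs_sign[OF pq(3)] by simp
  qed
  moreover have "z (xs ! p) = 1 \<or> z (xs ! p) = -1" "z (xs ! q) = 1 \<or> z (xs ! q) = -1"
    using abs_sign[OF pq(3)] abs_sign[OF pq(4)] by linarith+
  ultimately show "z (xs ! p) * z (xs ! q) < 0" by auto
qed

lemma feasible_imp_condition_B:
  assumes feasible: "\<forall>i\<in>{2..n} - S. \<bar>W i\<bar> < 1"
  shows "condition_B n pa f0"
  unfolding condition_B_def Let_def
proof (intro allI impI, elim conjE, goal_cases)
  case (1 v m br)
  note B = condition_B_at_ramification[OF 1]
  show ?case
    unfolding B(1) using B(2,3) feasible by blast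
qed

text \<open>
  A form that identifies the vertices of the star by where jumps are missing: after position \<open>k\<close> on
  the main branch, or before it on a side branch.
\<close>

lemma condition_B_imp_component:
  assumes B: "condition_B n pa f0"
    and v: "ramification_point n pa v" and m: "branch_path n pa m" "last m = v"
    and br: "\<forall>c\<in>children n pa v. branch_path n pa (br c) \<and> hd (br c) = c"
  shows "\<And>k. k < length m \<Longrightarrow> m ! k \<notin> S \<Longrightarrow> (\<And>l. k < l \<Longrightarrow> l < length m \<Longrightarrow> m ! l \<notin> S) \<Longrightarrow>
      \<bar>W (m ! k)\<bar> < 1"
    and "\<And>c k. c \<in> children n pa v \<Longrightarrow> br c ! k \<notin> S \<Longrightarrow> (\<And>l. l < k \<Longrightarrow> br c ! l \<notin> S) \<Longrightarrow>
      \<bar>W (br c ! k)\<bar> < 1"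
proof -
  note C = condition_B_at_ramification[OF v m br]
  have "ramification_point n pa v \<and> branch_path n pa m \<and> last m = v \<and>
      (\<forall>c\<in>children n pa v. branch_path n pa (br c) \<and> hd (br c) = c)"
    using v m br by blast
  from B[unfolded condition_B_def Let_def, THEN spec, THEN spec, THEN spec, THEN mp, OF this]
  have bounds: "(\<forall>l. length m - length (dropWhile (\<lambda>u. u \<noteq> last (filter (\<lambda>u. u \<in> S) m)) m) < l \<and>
        l < length m \<longrightarrow> \<bar>W (m ! l)\<bar> < 1) \<and>
      (\<forall>c\<in>children n pa v. \<forall>l<length (takeWhile (\<lambda>u. u \<noteq> hd (filter (\<lambda>u. u \<in> S) (br c))) (br c)).
        \<bar>W (br c ! l)\<bar> < 1)"
    unfolding C(1) .
  show "\<bar>W (m ! k)\<bar> < 1"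
    if k: "k < length m" "m ! k \<notin> S" and after: "\<And>l. k < l \<Longrightarrow> l < length m \<Longrightarrow> m ! l \<notin> S" for k
  proof -
    define p where "p = length m - length (dropWhile (\<lambda>u. u \<noteq> last (filter (\<lambda>u. u \<in> S) m)) m)"
    have "p < length m" "m ! p \<in> S"
      using C(4-6) unfolding p_def by simp_all
    then have "p \<noteq> k" "\<not> k < p"
      using k after by blast+
    then have "p < k" by simp
    then show ?thesis
      using bounds k(1) unfolding p_def by blast
  qed
  show "\<bar>W (br c ! k)\<bar> < 1"
    if c: "c \<in> children n pa v" and k: "br c ! k \<notin> S"
      and before: "\<And>l. l < k \<Longrightarrow> br c ! l \<notin> S" for c k
  proof -
    define q where "q = length (takeWhile (\<lambda>u. u \<noteq> hd (filter (\<lambda>u. u \<in> S) (br c))) (br c))"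
    have "br c ! q \<in> S"
      using C(7)[OF c] unfolding q_def by simp
    then have "q \<noteq> k" "\<not> q < k"
      using k before by blast+
    then have "k < q" by simp
    then show ?thesis
      using bounds c unfolding q_def by blast
  qed
qed

lemma W_segment_bound:
  assumes xs: "branch_path n pa xs" and "p < k" "k < q" "k < length xs"
    and none: "\<And>l. p < l \<Longrightarrow> l < k \<Longrightarrow> xs ! l \<notin> S"
    and "\<bar>W (xs ! p)\<bar> \<le> 1" "\<bar>B\<bar> \<le> 1" "W (xs ! p) \<noteq> B \<or> \<bar>W (xs ! p)\<bar> < 1"
    and "B = W (xs ! p) - real (q - p) * w (xs ! p)"
  shows "\<bar>W (xs ! k)\<bar> < 1"
proof -
  have "W (xs ! k) = W (xs ! p) - real (k - p) * w (xs ! p)"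
    using assms(2,4) none by (intro W_branch_linear[OF xs]) auto
  then show ?thesis
    using segment_bound[OF assms(6-8), of "k - p" "q - p" "w (xs ! p)"] assms(2,3,9) by simp
qed

text \<open>
  On a branch path through the vertex, look for the nearest jump on either side. If there is none
  towards the root, the path starts at the root, where \<open>W = 0\<close>, or below a ramification point; if
  there is none away from it, the path ends in a leaf or at a ramification point. Ramification
  points are dealt with by (B), two jumps by (A), and in the remaining cases one of
  the end values is \<open>0\<close>.
\<close>

lemma conditions_imp_feasible:
  assumes A: "condition_A n pa f0" and B: "condition_B n pa f0" and i: "i \<in> {2..n} - S"
  shows "\<bar>W i\<bar> < 1"
proof -
  have "i \<in> {1..n}" using i by auto
  then obtain xs where xs: "branch_path n pa xs" "i \<in> set xs"
    using branch_path_through[OF tree] by blast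
  note nth = branch_path_nth[OF xs(1)]
  obtain k where k: "k < length xs" "xs ! k = i"
    using xs(2) unfolding in_set_conv_nth by blast
  have k_notin: "xs ! k \<notin> S" and i1: "i \<noteq> 1"
    using i k(2) by auto
  have hd: "hd xs = xs ! 0"
    by (rule hd_conv_nth[OF nth(1)])
  have branches: "\<exists>br. \<forall>c\<in>children n pa v. branch_path n pa (br c) \<and> hd (br c) = c"
    if "ramification_point n pa v" for v
    by (intro bchoice ballI) (metis branch_path_from_child[OF tree that])
  \<comment> \<open>\<open>xs\<close> hangs below a ramification point and \<open>i\<close> comes before its first jump.\<close>
  have side: "\<bar>W i\<bar> < 1" if hd1: "hd xs \<noteq> 1" and before: "\<And>l. l < k \<Longrightarrow> xs ! l \<notin> S"
  proof -
    define v where "v = pa (hd xs)"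
    have v: "ramification_point n pa v"
      using xs(1) hd1 unfolding branch_path_def v_def by blast
    have "hd xs \<in> {1..n}"
      using nth(3) hd_in_set[OF nth(1)] by blast
    then have c: "hd xs \<in> children n pa v"
      using hd1 by (auto simp: children_def v_def)
    obtain m where m: "branch_path n pa m" "last m = v"
      using branch_path_to_ramification[OF tree v] by blast
    obtain br0 where br0: "\<forall>c\<in>children n pa v. branch_path n pa (br0 c) \<and> hd (br0 c) = c"
      using branches[OF v] by blast
    \<comment> \<open>Condition (B) holds for any choice of branches, so \<open>xs\<close> itself can be the one at its child.\<close>
    define br where "br = br0(hd xs := xs)"
    have br: "\<forall>c\<in>children n pa v. branch_path n pa (br c) \<and> hd (br c) = c"
      using br0 xs(1) by (simp add: br_def)
    have "\<bar>W (br (hd xs) ! k)\<bar> < 1"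
      using k_notin before
      by (intro condition_B_imp_component(2)[OF B v m br c]) (auto simp: br_def)
    then show ?thesis by (simp add: br_def k(2))
  qed
  show ?thesis
  proof (cases "\<exists>l>k. l < length xs \<and> xs ! l \<in> S")
    case True
    then obtain l where l: "k < l" "l < length xs" "xs ! l \<in> S" by blast
    obtain q where q: "k < q" "q \<le> l" "xs ! q \<in> S" "\<And>l'. k < l' \<Longrightarrow> l' < q \<Longrightarrow> xs ! l' \<notin> S"
      using first_from[of k l "\<lambda>l. xs ! l \<in> S"] l by blast
    have q_len: "q < length xs" using q(2) l(2) by simp
    show ?thesis
    proof (cases "\<exists>l<k. xs ! l \<in> S")
      case True
      then obtain p where p: "p < k" "xs ! p \<in> S" "\<And>l'. p < l' \<Longrightarrow> l' < k \<Longrightarrow> xs ! l' \<notin> S"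
        using last_before[of _ k "\<lambda>l. xs ! l \<in> S"] by blast
      have none: "xs ! l' \<notin> S" if "p < l'" "l' < q" for l'
        using that p(3) q(4) k_notin by (cases l' k rule: linorder_cases) auto
      have "z (xs ! p) * z (xs ! q) < 0"
        using A p(1,2) q(1,3) q_len none xs(1) unfolding condition_A_iff by (metis less_trans)
      then have "W (xs ! p) \<noteq> z (xs ! q)"
        using W_jump[OF p(2)] by (metis not_square_less_zero)
      moreover have "z (xs ! q) = W (xs ! p) - real (q - p) * w (xs ! p)"
        using W_branch_linear[OF xs(1), of p q] W_jump[OF q(3)] p(1) q(1) q_len none by simp
      ultimately have "\<bar>W (xs ! k)\<bar> < 1"
        using W_jump[OF p(2)] abs_sign[OF p(2)] abs_sign[OF q(3)] p(3)
        by (intro W_segment_bound[OF xs(1) p(1) q(1) k(1), of "z (xs ! q)"]) simp_all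
      then show ?thesis by (simp add: k(2))
    next
      case False
      show ?thesis
      proof (cases "hd xs = 1")
        case True
        then have root: "xs ! 0 = 1" using hd by simp
        then have "0 < k" using i1 k(2) by (cases k) auto
        have none: "xs ! l' \<notin> S" if "l' < q" for l'
          using that False q(4) k_notin by (cases l' k rule: linorder_cases) auto
        have W0: "W (xs ! 0) = 0" using W_root root by simp
        have "z (xs ! q) = W (xs ! 0) - real (q - 0) * w (xs ! 0)"
          using W_branch_linear[OF xs(1), of 0 q] W_jump[OF q(3)] q_len none by simp
        then have "\<bar>W (xs ! k)\<bar> < 1"
          using W0 abs_sign[OF q(3)] False
          by (intro W_segment_bound[OF xs(1) \<open>0 < k\<close> q(1) k(1), of "z (xs ! q)"]) simp_all
        then show ?thesis by (simp add: k(2))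
      next
        case hd1: False
        show ?thesis using side[OF hd1] False by blast
      qed
    qed
  next
    case False
    then have after: "xs ! l \<notin> S" if "k < l" "l < length xs" for l
      using that by blast
    show ?thesis
    proof (cases "ramification_point n pa (last xs)")
      case True
      obtain br where "\<forall>c\<in>children n pa (last xs). branch_path n pa (br c) \<and> hd (br c) = c"
        using branches[OF True] by blast
      then have "\<bar>W (xs ! k)\<bar> < 1"
        using condition_B_imp_component(1)[OF B True xs(1) refl _ k(1) k_notin after] by blast
      then show ?thesis by (simp add: k(2))
    next
      case False
      then have leaf: "children n pa (last xs) = {}"
        using xs(1) unfolding branch_path_def by blast
      show ?thesis
      proof (cases "\<exists>l<k. xs ! l \<in> S")
        case True
        then obtain p where p: "p < k" "xs ! p \<in> S" "\<And>l'. p < l' \<Longrightarrow> l' < k \<Longrightarrow> xs ! l' \<notin> S"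
          using last_before[of _ k "\<lambda>l. xs ! l \<in> S"] by blast
        have none: "xs ! l' \<notin> S" if "p < l'" "l' < length xs" for l'
          using that p(3) after k_notin by (cases l' k rule: linorder_cases) auto
        have leaf_eq: "0 = W (xs ! p) - real (length xs - p) * w (xs ! p)"
          using p(1) k(1) by (intro W_branch_leaf[OF xs(1) _ leaf none]) simp_all
        have "\<bar>W (xs ! p)\<bar> = 1"
          using W_jump[OF p(2)] abs_sign[OF p(2)] by simp
        then have "\<bar>W (xs ! p)\<bar> \<le> 1" "W (xs ! p) \<noteq> 0 \<or> \<bar>W (xs ! p)\<bar> < 1"
          by auto
        then have "\<bar>W (xs ! k)\<bar> < 1"
          using W_segment_bound[OF xs(1) p(1) k(1) k(1) p(3) _ _ _ leaf_eq] by simp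
        then show ?thesis by (simp add: k(2))
      next
        case no_jump: False
        show ?thesis
        proof (cases "hd xs = 1")
          case True
          then have root: "xs ! 0 = 1" using hd by simp
          then have "0 < k" using i1 k(2) by (cases k) auto
          have none: "xs ! l' \<notin> S" if "l' < length xs" for l'
            using that no_jump after k_notin by (cases l' k rule: linorder_cases) auto
          have W0: "W (xs ! 0) = 0" using W_root root by simp
          have "0 = W (xs ! 0) - real (length xs - 0) * w (xs ! 0)"
            using k(1) none by (intro W_branch_leaf[OF xs(1) _ leaf]) auto
          then have "\<bar>W (xs ! k)\<bar> < 1"
            using W0 no_jump
            by (intro W_segment_bound[OF xs(1) \<open>0 < k\<close> k(1) k(1), of 0]) simp_all
          then show ?thesis by (simp add: k(2))
        next
          case False
          then show ?thesis using side no_jump by blast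
        qed
      qed
    qed
  qed
qed

lemma feasible_iff_conditions:
  "(\<forall>i\<in>{2..n} - S. \<bar>W i\<bar> < 1) \<longleftrightarrow> condition_A n pa f0 \<and> condition_B n pa f0"
  using feasible_imp_condition_A feasible_imp_condition_B conditions_imp_feasible by blast

end

theorem theorem7p8:
  fixes n :: nat and pa :: "nat \<Rightarrow> nat" and f0 :: "nat \<Rightarrow> real"
    and lam \<sigma> :: real and M :: "'a measure"
    and \<epsilon> :: "nat \<Rightarrow> 'a \<Rightarrow> real" and fhat :: "'a \<Rightarrow> nat \<Rightarrow> real"
  assumes "rooted_tree n pa"
    and "vertex_degree n pa 1 \<le> 1"
    and "\<sigma> > 0"
    and "lam \<ge> 0"
    and "gaussian_noise M n \<sigma> \<epsilon>"
    and "\<And>\<omega>. \<omega> \<in> space M \<Longrightarrow> edge_lasso_estimator n pa lam (\<lambda>i. f0 i + \<epsilon> i \<omega>) (fhat \<omega>)"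
    and "large_enough n pa (true_jumps n pa f0)"
    and "jumps_around_ramifications n pa (true_jumps n pa f0)"
  shows "irrepresentable_condition n pa f0 \<longleftrightarrow> condition_A n pa f0 \<and> condition_B n pa f0"
proof -
  obtain w where w: "\<And>i. i \<in> {2..n} - true_jumps n pa f0 \<Longrightarrow> w i = w (pa i)"
    "subtree_sum n pa w 1 = 0"
    "\<And>j. j \<in> true_jumps n pa f0 \<Longrightarrow> subtree_sum n pa w j = jump_sgn pa f0 j"
    and irrepresentable: "irrepresentable_condition n pa f0 \<longleftrightarrow>
      (\<forall>i\<in>{2..n} - true_jumps n pa f0. \<bar>subtree_sum n pa w i\<bar> < 1)"
    using irrepresentable_condition_profile[OF assms(1), of f0] by blast
  interpret jump_profile n pa f0 w
  proof
    fix e assume e: "e \<in> true_jumps n pa f0"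
    then have e2: "e \<in> {2..n}" by (simp add: true_jumps_def)
    show "\<not> ramification_point n pa e \<and> \<not> ramification_point n pa (pa e) \<and>
        pa e \<notin> true_jumps n pa f0"
      using large_enough_jump_isolated[OF assms(1,7) e e2] by (auto simp: true_jumps_def)
  qed (use assms w in auto)
  show ?thesis
    unfolding irrepresentable by (rule feasible_iff_conditions)
qed

end
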